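(* Let $M$ be a compact boundaryless Riemannian surface, let $f\in\mathrm{Diff}^1(M)$ and let $\Lambda\subset M$ be a compact $f$-invariant set. For $\delta>0$ put $\Lambda_\delta=\bigcap_{n\in\mathbb Z}f^n\big(\Lambda\setminus B_\delta(\mathrm{Crit}(f,\Lambda))\big)$. Suppose there exists $\delta_0>0$ such that $\Lambda_{\delta_0}$ is non-empty. Then for any $\varepsilon>0$ and $0<\delta<\delta_0$ there exists a positive integer $N_0$ such that the following holds, where $E\oplus F$ is the dominated splitting of $\Lambda_\delta$. (1) If $c\in\mathrm{Crit}(f,\Lambda)$, with critical direction $v$, satisfies $f^{-j}(c)\notin B_\delta(\mathrm{Crit}(f,\Lambda))$ for all $0<j\le n$, with $n>N_0$, then there exists a positive integer $n^*\le n$ such that $f^{-n^*}(c)\in B_\varepsilon(\Lambda_\delta)$ and $\mathrm{slope}(G^{-n^*}(v),F)<\varepsilon$. (2) If $c\in\mathrm{Crit}(f,\Lambda)$, with critical direction $v$, satisfies $f^{j}(c)\notin B_\delta(\mathrm{Crit}(f,\Lambda))$ for all $0<j\le n$, with $n>N_0$, then there exists a positive integer $n^*\le n$ such that $f^{n^*}(c)\in B_\varepsilon(\Lambda_\delta)$ and $\mathrm{slope}(G^{n^*}(v),E)<\varepsilon$.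
   Context: Projective cocycle: for $x\in M$ and a unit vector $v\in T^1_xM$, put $G(v)=D_xf(v)/\|D_xf(v)\|\in T^1_{f(x)}M$. For $n\in\mathbb Z$, $G^n$ is the $n$-th iterate and $g^n(v)>0$ is the absolute value of the derivative at $v$ of $G^n:T^1_xM\to T^1_{f^n(x)}M$; equivalently $g^n(v)=|\det D_xf^n|/\|D_xf^n(v)\|^2$. Critical points: $x\in\Lambda$ is critical if there is $v\in T^1_xM$ (a critical direction) with $g^n(v)\ge1$ for all $n\in\mathbb Z$; $\mathrm{Crit}(f,\Lambda)$ is the set of critical points in $\Lambda$. $B_r(A)$ denotes the open $r$-neighborhood of a set $A$. The set $\Lambda_\delta$ is compact, invariant and contains no critical points. Dominated splitting over a compact invariant set $K$: a $Df$-invariant splitting $T_KM=E\oplus F$ into one-dimensional subbundles with constants $C>0$, $\lambda\in(0,1)$ such that $\|Df^n_{|E_x}\|\le C\lambda^n\|Df^n_{|F_x}\|$ for all $x\in K$, $n\ge0$; $E$ is the center-stable and $F$ the center-unstable subbundle. The statement presupposes that $\Lambda_\delta$ carries such a splitting. Slope: for a direction $w$ at a point $y\in B_\varepsilon(\Lambda_\delta)$, $\mathrm{slope}(w,F)<\varepsilon$ means that there is $y'\in\Lambda_\delta$ with $d(y,y')<\varepsilon$ such that the slope (angle) between the line spanned by $w$ and $F_{y'}$ is less than $\varepsilon$, tangent spaces at nearby points being identified by fixed local coordinates; similarly for $E$. *)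

theory Defs
  imports "HOL-Analysis.Analysis"
begin

section \<open>Functions of class C^k on open subsets of Euclidean spaces\<close>

primrec Ck_on :: "nat \<Rightarrow> ('a::euclidean_space \<Rightarrow> 'b::real_normed_vector) \<Rightarrow> 'a set \<Rightarrow> bool" where
  "Ck_on 0 f U \<longleftrightarrow> continuous_on U f"
| "Ck_on (Suc k) f U \<longleftrightarrow>
     (\<forall>x\<in>U. f differentiable (at x)) \<and>
     (\<forall>b\<in>Basis. Ck_on k (\<lambda>x. frechet_derivative f (at x) b) U)"

definition smooth_on :: "('a::euclidean_space \<Rightarrow> 'b::real_normed_vector) \<Rightarrow> 'a set \<Rightarrow> bool" where
  "smooth_on f U \<longleftrightarrow> (\<forall>k. Ck_on k f U)"


section \<open>Riemannian surfaces\<close>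

text \<open>
  The points of a surface form a whole type \<open>'m\<close>. A chart is a pair of a domain and a coordinate
  map, whose values outside the domain are irrelevant. The tangent space at a point \<open>x\<close> is the
  vector space \<open>real^2\<close>, a vector being represented by its coordinates in the chart
  \<open>chart_at S x\<close>, which is chosen once and for all from the atlas; this choice need not depend on
  \<open>x\<close> in any regular way. The number \<open>metric S x v w\<close> is the inner product of two vectors
  \<open>v, w\<close> tangent at \<open>x\<close>.
\<close>

type_synonym 'm chart = "'m set \<times> ('m \<Rightarrow> real^2)"

record 'm riem_surface =
  atlas :: "'m chart set"
  chart_at :: "'m \<Rightarrow> 'm chart"
  metric :: "'m \<Rightarrow> real^2 \<Rightarrow> real^2 \<Rightarrow> real"

definition chart_inv :: "'m chart \<Rightarrow> real^2 \<Rightarrow> 'm" where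
  "chart_inv c = inv_into (fst c) (snd c)"

definition smooth_atlas :: "'m::metric_space chart set \<Rightarrow> bool" where
  "smooth_atlas A \<longleftrightarrow>
     (\<forall>c\<in>A. open (fst c) \<and> open (snd c ` fst c) \<and>
             homeomorphism (fst c) (snd c ` fst c) (snd c) (chart_inv c)) \<and>
     (\<Union>c\<in>A. fst c) = UNIV \<and>
     (\<forall>c\<in>A. \<forall>d\<in>A. smooth_on (snd d \<circ> chart_inv c) (snd c ` (fst c \<inter> fst d)))"

text \<open>The differential at the point \<open>x\<close> of the change of coordinates from \<open>c\<close> to \<open>d\<close>.\<close>

definition coord_change :: "'m chart \<Rightarrow> 'm chart \<Rightarrow> 'm \<Rightarrow> real^2 \<Rightarrow> real^2" where
  "coord_change c d x = frechet_derivative (snd d \<circ> chart_inv c) (at (snd c x))"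

text \<open>
  The coordinates, in the chart \<open>c\<close>, of a vector tangent at \<open>x\<close>; and the vector tangent at \<open>x\<close>
  with given coordinates in the chart \<open>c\<close>.
\<close>

definition to_coords :: "'m riem_surface \<Rightarrow> 'm chart \<Rightarrow> 'm \<Rightarrow> real^2 \<Rightarrow> real^2" where
  "to_coords S c x = coord_change (chart_at S x) c x"

definition of_coords :: "'m riem_surface \<Rightarrow> 'm chart \<Rightarrow> 'm \<Rightarrow> real^2 \<Rightarrow> real^2" where
  "of_coords S c x = coord_change c (chart_at S x) x"

definition inner_product :: "(real^2 \<Rightarrow> real^2 \<Rightarrow> real) \<Rightarrow> bool" where
  "inner_product g \<longleftrightarrow>
     bilinear g \<and> (\<forall>v w. g v w = g w v) \<and> (\<forall>v. v \<noteq> 0 \<longrightarrow> g v v > 0)"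

definition smooth_metric :: "'m riem_surface \<Rightarrow> bool" where
  "smooth_metric S \<longleftrightarrow>
     (\<forall>c\<in>atlas S. \<forall>a b.
        smooth_on (\<lambda>z. let p = chart_inv c z
                        in metric S p (of_coords S c p a) (of_coords S c p b))
                  (snd c ` fst c))"

definition rnorm :: "'m riem_surface \<Rightarrow> 'm \<Rightarrow> real^2 \<Rightarrow> real" where
  "rnorm S x v = sqrt (metric S x v v)"

text \<open>Curves of class C^1 on a closed interval (with one-sided derivatives at the ends).\<close>

definition C1_arc :: "'m riem_surface \<Rightarrow> (real \<Rightarrow> 'm) \<Rightarrow> real \<Rightarrow> real \<Rightarrow> bool" where
  "C1_arc S \<gamma> a b \<longleftrightarrow>
     (\<forall>c\<in>atlas S. \<exists>\<gamma>'. continuous_on {t\<in>{a..b}. \<gamma> t \<in> fst c} \<gamma>' \<and>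
        (\<forall>t\<in>{a..b}. \<gamma> t \<in> fst c \<longrightarrow>
           ((snd c \<circ> \<gamma>) has_vector_derivative \<gamma>' t) (at t within {a..b})))"

definition piecewise_C1_curve :: "'m::metric_space riem_surface \<Rightarrow> (real \<Rightarrow> 'm) \<Rightarrow> bool" where
  "piecewise_C1_curve S \<gamma> \<longleftrightarrow>
     continuous_on {0..1} \<gamma> \<and>
     (\<exists>P. finite P \<and>
        (\<forall>a b. 0 \<le> a \<and> a < b \<and> b \<le> 1 \<and> {a<..<b} \<inter> P = {} \<longrightarrow> C1_arc S \<gamma> a b))"

definition curve_length :: "'m riem_surface \<Rightarrow> (real \<Rightarrow> 'm) \<Rightarrow> real" where
  "curve_length S \<gamma> =
     integral {0..1}
       (\<lambda>t. rnorm S (\<gamma> t) (vector_derivative (snd (chart_at S (\<gamma> t)) \<circ> \<gamma>) (at t)))"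

definition lengths_between :: "'m::metric_space riem_surface \<Rightarrow> 'm \<Rightarrow> 'm \<Rightarrow> real set" where
  "lengths_between S x y =
     {curve_length S \<gamma> |\<gamma>. piecewise_C1_curve S \<gamma> \<and> \<gamma> 0 = x \<and> \<gamma> 1 = y}"

text \<open>
  The distance \<open>dist\<close> of the type \<open>'m\<close> is the Riemannian distance. The surface is not required to
  be connected; points in different components, which no curve joins, may be at any distance
  compatible with the topology.
\<close>

definition riemannian_surface :: "'m::metric_space riem_surface \<Rightarrow> bool" where
  "riemannian_surface S \<longleftrightarrow>
     smooth_atlas (atlas S) \<and>
     (\<forall>x. chart_at S x \<in> atlas S \<and> x \<in> fst (chart_at S x)) \<and>
     (\<forall>x. inner_product (metric S x)) \<and>
     smooth_metric S \<and>
     (\<forall>x y. lengths_between S x y \<noteq> {} \<longrightarrow> dist x y = Inf (lengths_between S x y))"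


section \<open>Diffeomorphisms and the projective cocycle\<close>

definition C1_map :: "'m::metric_space riem_surface \<Rightarrow> ('m \<Rightarrow> 'm) \<Rightarrow> bool" where
  "C1_map S f \<longleftrightarrow>
     continuous_on UNIV f \<and>
     (\<forall>c\<in>atlas S. \<forall>d\<in>atlas S.
        Ck_on 1 (snd d \<circ> f \<circ> chart_inv c) (snd c ` (fst c \<inter> f -` fst d)))"

definition C1_diffeo :: "'m::metric_space riem_surface \<Rightarrow> ('m \<Rightarrow> 'm) \<Rightarrow> bool" where
  "C1_diffeo S f \<longleftrightarrow> bij f \<and> C1_map S f \<and> C1_map S (inv f)"

definition differential :: "'m riem_surface \<Rightarrow> ('m \<Rightarrow> 'm) \<Rightarrow> 'm \<Rightarrow> real^2 \<Rightarrow> real^2" where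
  "differential S f x =
     frechet_derivative (snd (chart_at S (f x)) \<circ> f \<circ> chart_inv (chart_at S x))
       (at (snd (chart_at S x) x))"

text \<open>The iterates, of any integer order, of a bijection \<open>h\<close> of the set \<open>X\<close>.\<close>

definition iter :: "'a set \<Rightarrow> ('a \<Rightarrow> 'a) \<Rightarrow> int \<Rightarrow> 'a \<Rightarrow> 'a" where
  "iter X h n = (if n \<ge> 0 then h ^^ nat n else (inv_into X h) ^^ nat (- n))"

abbreviation point_iter :: "('m \<Rightarrow> 'm) \<Rightarrow> int \<Rightarrow> 'm \<Rightarrow> 'm" where
  "point_iter f \<equiv> iter UNIV f"

definition unit_vectors :: "'m riem_surface \<Rightarrow> 'm \<Rightarrow> (real^2) set" where
  "unit_vectors S x = {v. rnorm S x v = 1}"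

definition unit_bundle :: "'m riem_surface \<Rightarrow> ('m \<times> (real^2)) set" where
  "unit_bundle S = Sigma UNIV (unit_vectors S)"

definition proj_cocycle ::
    "'m riem_surface \<Rightarrow> ('m \<Rightarrow> 'm) \<Rightarrow> 'm \<times> (real^2) \<Rightarrow> 'm \<times> (real^2)" where
  "proj_cocycle S f = (\<lambda>(x, v).
     (f x, differential S f x v /\<^sub>R rnorm S (f x) (differential S f x v)))"

definition proj_iter ::
    "'m riem_surface \<Rightarrow> ('m \<Rightarrow> 'm) \<Rightarrow> int \<Rightarrow> 'm \<Rightarrow> real^2 \<Rightarrow> real^2" where
  "proj_iter S f n x v = snd (iter (unit_bundle S) (proj_cocycle S f) n (x, v))"

text \<open>
  The circle of unit vectors at \<open>x\<close> is parametrised by arc length, starting from \<open>v\<close>, by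
  \<open>cos t *\<^sub>R v + sin t *\<^sub>R w\<close> for a unit vector \<open>w\<close> orthogonal to \<open>v\<close>; so the absolute value of
  the derivative at \<open>v\<close> of a map between circles of unit vectors is the norm of the velocity at
  \<open>t = 0\<close> of the image of this curve. It is the same for both choices of \<open>w\<close>.
\<close>

definition unit_normal :: "'m riem_surface \<Rightarrow> 'm \<Rightarrow> real^2 \<Rightarrow> real^2" where
  "unit_normal S x v = (SOME w. rnorm S x w = 1 \<and> metric S x v w = 0)"

definition proj_deriv :: "'m riem_surface \<Rightarrow> ('m \<Rightarrow> 'm) \<Rightarrow> int \<Rightarrow> 'm \<Rightarrow> real^2 \<Rightarrow> real" where
  "proj_deriv S f n x v =
     rnorm S (point_iter f n x)
       (vector_derivative
          (\<lambda>t. proj_iter S f n x (cos t *\<^sub>R v + sin t *\<^sub>R unit_normal S x v)) (at 0))"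


section \<open>Critical points\<close>

definition critical_direction ::
    "'m riem_surface \<Rightarrow> ('m \<Rightarrow> 'm) \<Rightarrow> 'm \<Rightarrow> real^2 \<Rightarrow> bool" where
  "critical_direction S f x v \<longleftrightarrow>
     v \<in> unit_vectors S x \<and> (\<forall>n. proj_deriv S f n x v \<ge> 1)"

definition Crit :: "'m riem_surface \<Rightarrow> ('m \<Rightarrow> 'm) \<Rightarrow> 'm set \<Rightarrow> 'm set" where
  "Crit S f \<Lambda> = {x\<in>\<Lambda>. \<exists>v. critical_direction S f x v}"

definition nbhd :: "real \<Rightarrow> 'm::metric_space set \<Rightarrow> 'm set" where
  "nbhd r A = (\<Union>a\<in>A. ball a r)"

definition away_from_Crit ::
    "'m::metric_space riem_surface \<Rightarrow> ('m \<Rightarrow> 'm) \<Rightarrow> 'm set \<Rightarrow> real \<Rightarrow> 'm set" where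
  "away_from_Crit S f \<Lambda> \<delta> =
     (\<Inter>n::int. point_iter f n ` (\<Lambda> - nbhd \<delta> (Crit S f \<Lambda>)))"


section \<open>Dominated splittings\<close>

text \<open>
  A one-dimensional (continuous) subbundle of the tangent bundle over \<open>K\<close>: near each point of
  \<open>K\<close> it is spanned, in local coordinates, by a continuous nowhere vanishing vector field.
\<close>

definition line_subbundle ::
    "'m::metric_space riem_surface \<Rightarrow> 'm set \<Rightarrow> ('m \<Rightarrow> (real^2) set) \<Rightarrow> bool" where
  "line_subbundle S K L \<longleftrightarrow>
     (\<forall>x\<in>K. subspace (L x) \<and> dim (L x) = 1) \<and>
     (\<forall>x0\<in>K. \<exists>V s. open V \<and> x0 \<in> V \<and> V \<subseteq> fst (chart_at S x0) \<and>
        continuous_on (K \<inter> V) s \<and>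
        (\<forall>x\<in>K \<inter> V. s x \<noteq> 0 \<and> to_coords S (chart_at S x0) x ` L x = span {s x}))"

text \<open>The operator norm of the restriction of the differential of \<open>h\<close> at \<open>x\<close> to the subspace \<open>L\<close>.\<close>

definition restr_norm ::
    "'m riem_surface \<Rightarrow> ('m \<Rightarrow> 'm) \<Rightarrow> 'm \<Rightarrow> (real^2) set \<Rightarrow> real" where
  "restr_norm S h x L =
     Sup {rnorm S (h x) (differential S h x v) |v. v \<in> L \<and> rnorm S x v = 1}"

definition dominated_splitting ::
    "'m::metric_space riem_surface \<Rightarrow> ('m \<Rightarrow> 'm) \<Rightarrow> 'm set \<Rightarrow>
     ('m \<Rightarrow> (real^2) set) \<Rightarrow> ('m \<Rightarrow> (real^2) set) \<Rightarrow> bool" where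
  "dominated_splitting S f K E F \<longleftrightarrow>
     line_subbundle S K E \<and> line_subbundle S K F \<and>
     (\<forall>x\<in>K. E x \<inter> F x = {0}) \<and>
     (\<forall>x\<in>K. differential S f x ` E x = E (f x) \<and> differential S f x ` F x = F (f x)) \<and>
     (\<exists>C>0. \<exists>r>0. r < 1 \<and>
        (\<forall>x\<in>K. \<forall>n. restr_norm S (f ^^ n) x (E x) \<le> C * r ^ n * restr_norm S (f ^^ n) x (F x)))"


section \<open>Slopes\<close>

text \<open>
  The fixed local coordinates that identify the tangent spaces at nearby points: finitely many
  charts covering the surface.
\<close>

definition local_coordinates :: "'m riem_surface \<Rightarrow> 'm chart set \<Rightarrow> bool" where
  "local_coordinates S Q \<longleftrightarrow> finite Q \<and> Q \<subseteq> atlas S \<and> (\<Union>c\<in>Q. fst c) = UNIV"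

text \<open>The vector tangent at \<open>y'\<close> that has the same coordinates in \<open>c\<close> as \<open>w\<close>, tangent at \<open>y\<close>.\<close>

definition identify ::
    "'m riem_surface \<Rightarrow> 'm chart \<Rightarrow> 'm \<Rightarrow> 'm \<Rightarrow> real^2 \<Rightarrow> real^2" where
  "identify S c y y' w = of_coords S c y' (to_coords S c y w)"

definition line_angle :: "'m riem_surface \<Rightarrow> 'm \<Rightarrow> real^2 \<Rightarrow> real^2 \<Rightarrow> real" where
  "line_angle S x v w = arccos (\<bar>metric S x v w\<bar> / (rnorm S x v * rnorm S x w))"

text \<open>
  \<open>slope(w, L) < \<epsilon>\<close> for a direction \<open>w\<close> at \<open>y\<close> and a line field \<open>L\<close> over \<open>K\<close>. The points \<open>y\<close>
  and \<open>y'\<close> have to lie in a common chart of the fixed system, and the angle has to be small in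
  every such chart.
\<close>

definition slope_less ::
    "'m::metric_space riem_surface \<Rightarrow> 'm chart set \<Rightarrow> 'm set \<Rightarrow> 'm \<Rightarrow> real^2 \<Rightarrow>
     ('m \<Rightarrow> (real^2) set) \<Rightarrow> real \<Rightarrow> bool" where
  "slope_less S Q K y w L \<epsilon> \<longleftrightarrow>
     (\<exists>y'\<in>K. dist y y' < \<epsilon> \<and>
        (\<exists>c\<in>Q. y \<in> fst c \<and> y' \<in> fst c) \<and>
        (\<forall>c\<in>Q. y \<in> fst c \<and> y' \<in> fst c \<longrightarrow>
           (\<exists>u\<in>L y'. u \<noteq> 0 \<and> line_angle S y' (identify S c y y' w) u < \<epsilon>)))"

end

theory Submission
  imports Defs
begin

text \<open>
  Suppose that the orbit of a critical direction stays away from the critical set for a long time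
  without its direction ever coming close to the contracted bundle \<open>E\<close>. By compactness, the
  limits of the directions in the middle of such orbit segments are directions at points of
  \<open>\<Lambda>\<^sub>\<delta>\<close> whose whole orbit avoids \<open>E\<close>; since the backward iterates of any direction outside
  \<open>F\<close> converge to \<open>E\<close>, these limits lie in \<open>F\<close>. On \<open>F\<close> some iterate \<open>g\<^sup>L\<close> of the cocycle is
  less than \<open>1/2\<close>, so \<open>g\<^sup>L < 1/2\<close> all along the middle of the segment, and by the chain rule \<open>g\<^sup>n\<close>
  becomes less than \<open>1\<close>, contrary to criticality. This is (2); (1) is (2) for the inverse
  of \<open>f\<close>, which exchanges \<open>E\<close> and \<open>F\<close>.
\<close>

section \<open>Differentials in charts\<close>

text \<open>Contraction on \<open>F\<close> comes from the formula
  \<open>|det Dh^n| / |Dh^n v|^2\<close> for the derivative of the cocycle: the angle between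
  \<open>E\<close> and \<open>F\<close> is bounded below, so the determinant is at most a constant
  times the product of the growths along \<open>E\<close> and along \<open>F\<close>, and domination
  makes the quotient of order \<open>r ^ n\<close>. The limit argument yields a margin
  \<open>M\<close>, the same for all orbits, such that the halving holds at every time at least
  \<open>M\<close> away from both ends of the segment. Nothing is known about the first
  \<open>M\<close> steps, but by compactness they multiply the derivative by a bounded factor, which
  a fixed number of halvings outweighs; this is where the threshold on \<open>n\<close> comes from.
  The obstacle that shapes the text is that a tangent vector is stored in a chart chosen point by
  point without any regularity. The pairs of points and vectors therefore carry no usable topology,
  and continuity, compactness and closedness are all expressed by sequences read in one chart around
  the limit point.\<close>

lemma Ck_on_1_frechet_tendsto:
  fixes \<phi> :: "'a::euclidean_space \<Rightarrow> 'b::real_normed_vector"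
  assumes \<phi>: "Ck_on 1 \<phi> U" and U: "open U" "z \<in> U"
    and z: "zs \<longlonglongrightarrow> z" and v: "vs \<longlonglongrightarrow> v"
  shows "(\<lambda>k. frechet_derivative \<phi> (at (zs k)) (vs k)) \<longlonglongrightarrow> frechet_derivative \<phi> (at z) v"
proof -
  have diff: "\<phi> differentiable (at x)" if "x \<in> U" for x
    using \<phi> that by simp
  have cont: "continuous_on U (\<lambda>x. frechet_derivative \<phi> (at x) b)" if "b \<in> Basis" for b
    using \<phi> that by simp
  \<comment> \<open>\<open>Ck_on\<close> gives continuity in the base point for each basis vector
    only; the expansion separates the base point from the vector, so that both may vary.\<close>
  have expand: "frechet_derivative \<phi> (at x) w = (\<Sum>b\<in>Basis. (w \<bullet> b) *\<^sub>R frechet_derivative \<phi> (at x) b)"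
    if "x \<in> U" for x w
  proof -
    have "linear (frechet_derivative \<phi> (at x))"
      using diff[OF that] by (rule linear_frechet_derivative)
    then have "frechet_derivative \<phi> (at x) (\<Sum>b\<in>Basis. (w \<bullet> b) *\<^sub>R b) =
        (\<Sum>b\<in>Basis. (w \<bullet> b) *\<^sub>R frechet_derivative \<phi> (at x) b)"
      by (simp add: linear_sum linear_scale)
    then show ?thesis
      by (simp add: euclidean_representation)
  qed
  have ev: "eventually (\<lambda>k. zs k \<in> U) sequentially"
    using z U topological_tendstoD by blast
  have "(\<lambda>k. \<Sum>b\<in>Basis. (vs k \<bullet> b) *\<^sub>R frechet_derivative \<phi> (at (zs k)) b)
      \<longlonglongrightarrow> (\<Sum>b\<in>Basis. (v \<bullet> b) *\<^sub>R frechet_derivative \<phi> (at z) b)"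
    using continuous_on_tendsto_compose[OF cont z U(2) ev]
    by (intro tendsto_sum tendsto_scaleR tendsto_inner v tendsto_const) auto
  then have "(\<lambda>k. \<Sum>b\<in>Basis. (vs k \<bullet> b) *\<^sub>R frechet_derivative \<phi> (at (zs k)) b)
      \<longlonglongrightarrow> frechet_derivative \<phi> (at z) v"
    unfolding expand[OF U(2), of v, symmetric] .
  then show ?thesis
    by (rule Lim_transform_eventually) (use ev in eventually_elim, rule expand[symmetric])
qed

text \<open>With \<open>h = id\<close> this is a change of coordinates, and with
  \<open>chart_at\<close> at both ends it is \<open>differential\<close>; so a single chain rule and
  a single continuity statement cover \<open>to_coords\<close>, \<open>of_coords\<close> and
  \<open>differential\<close>.\<close>

definition chart_deriv ::
    "'m chart \<Rightarrow> 'm chart \<Rightarrow> ('m \<Rightarrow> 'm) \<Rightarrow> 'm \<Rightarrow> real^2 \<Rightarrow> real^2" where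
  "chart_deriv c d h x = frechet_derivative (snd d \<circ> h \<circ> chart_inv c) (at (snd c x))"

text \<open>Convergence of tangent vectors at varying base points. Since \<open>chart_at S x\<close> depends on
  \<open>x\<close> in an arbitrary way, this is not convergence in \<open>'m \<times> real^2\<close>.\<close>

definition tconv ::
    "'m::metric_space riem_surface \<Rightarrow> (nat \<Rightarrow> 'm) \<Rightarrow> (nat \<Rightarrow> real^2) \<Rightarrow> 'm \<Rightarrow> real^2 \<Rightarrow> bool" where
  "tconv S xs vs y w \<longleftrightarrow> xs \<longlonglongrightarrow> y \<and>
     (\<forall>c\<in>atlas S. y \<in> fst c \<longrightarrow>
        (\<lambda>k. to_coords S c (xs k) (vs k)) \<longlonglongrightarrow> to_coords S c y w)"

locale surface =
  fixes S :: "'m::metric_space riem_surface"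
  assumes surface: "riemannian_surface S"
begin

lemma smooth_atlas: "smooth_atlas (atlas S)"
  using surface by (simp add: riemannian_surface_def)

lemma chart_at [simp]: "chart_at S x \<in> atlas S" "x \<in> fst (chart_at S x)"
  using surface by (auto simp: riemannian_surface_def)

lemma chart_homeo:
  assumes "c \<in> atlas S"
  shows "homeomorphism (fst c) (snd c ` fst c) (snd c) (chart_inv c)"
  using smooth_atlas assms by (auto simp: smooth_atlas_def)

lemma open_chart:
  assumes "c \<in> atlas S"
  shows "open (fst c)" "open (snd c ` fst c)"
  using smooth_atlas assms by (auto simp: smooth_atlas_def)

lemma chart_inv [simp]:
  assumes "c \<in> atlas S" "x \<in> fst c"
  shows "chart_inv c (snd c x) = x"
  using chart_homeo[OF assms(1)] assms(2) by (simp add: homeomorphism_def)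

lemma chart_tendsto:
  assumes "c \<in> atlas S" "x \<in> fst c" "xs \<longlonglongrightarrow> x"
  shows "(\<lambda>k. snd c (xs k)) \<longlonglongrightarrow> snd c x"
proof -
  have "continuous_on (fst c) (snd c)"
    using chart_homeo[OF assms(1)] by (simp add: homeomorphism_def)
  moreover have "eventually (\<lambda>k. xs k \<in> fst c) sequentially"
    using assms open_chart topological_tendstoD by blast
  ultimately show ?thesis
    using continuous_on_tendsto_compose assms by blast
qed

lemma chart_inv_tendsto:
  assumes "c \<in> atlas S" "x \<in> fst c" "(zs \<longlongrightarrow> snd c x) F"
  shows "((\<lambda>k. chart_inv c (zs k)) \<longlongrightarrow> x) F"
proof -
  have "continuous_on (snd c ` fst c) (chart_inv c)"
    using chart_homeo[OF assms(1)] by (simp add: homeomorphism_def)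
  moreover have "eventually (\<lambda>k. zs k \<in> snd c ` fst c) F"
    using assms open_chart(2)[OF assms(1)] topological_tendstoD by blast
  ultimately have "((\<lambda>k. chart_inv c (zs k)) \<longlongrightarrow> chart_inv c (snd c x)) F"
    using continuous_on_tendsto_compose assms(2,3) by blast
  then show ?thesis
    using assms by simp
qed

lemma open_chart_preimage:
  assumes "c \<in> atlas S" "open V"
  shows "open (snd c ` (fst c \<inter> V))"
proof -
  have "openin (top_of_set (fst c)) (fst c \<inter> V)"
    using assms by auto
  then have "openin (top_of_set (snd c ` fst c)) (snd c ` (fst c \<inter> V))"
    using homeomorphism_imp_open_map[OF chart_homeo[OF assms(1)]] by blast
  then show ?thesis
    using openin_open_trans open_chart(2)[OF assms(1)] by blast
qed

section \<open>Chain rule and composition of C1 maps\<close>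

lemma C1_map_id: "C1_map S id"
  using smooth_atlas unfolding C1_map_def smooth_atlas_def smooth_on_def
  by (auto simp del: Ck_on.simps One_nat_def simp: continuous_on_id id_def[symmetric])

lemma C1_map_continuous: "C1_map S h \<Longrightarrow> continuous_on UNIV h"
  by (simp add: C1_map_def)

lemma C1_map_tendsto: "C1_map S h \<Longrightarrow> (xs \<longlongrightarrow> x) F \<Longrightarrow> ((\<lambda>k. h (xs k)) \<longlongrightarrow> h x) F"
  using C1_map_continuous continuous_on_tendsto_compose[of UNIV h xs x F] by auto

context
  fixes c d :: "'m chart" and h :: "'m \<Rightarrow> 'm"
  assumes h: "C1_map S h" and c: "c \<in> atlas S" and d: "d \<in> atlas S"
begin

lemma open_chart_vimage: "open (snd c ` (fst c \<inter> h -` fst d))"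
  using open_chart_preimage[OF c] C1_map_continuous[OF h] open_chart(1)[OF d]
  by (simp add: open_vimage)

lemma Ck_on_chart: "Ck_on 1 (snd d \<circ> h \<circ> chart_inv c) (snd c ` (fst c \<inter> h -` fst d))"
  using h c d by (simp add: C1_map_def)

lemma chart_deriv:
  assumes "x \<in> fst c" "h x \<in> fst d"
  shows "((snd d \<circ> h \<circ> chart_inv c) has_derivative chart_deriv c d h x) (at (snd c x))"
proof -
  have "(snd d \<circ> h \<circ> chart_inv c) differentiable (at (snd c x))"
    using Ck_on_chart assms by auto
  then show ?thesis
    by (simp add: chart_deriv_def frechet_derivative_works)
qed

lemma chart_deriv_tendsto:
  assumes "x \<in> fst c" "h x \<in> fst d" "xs \<longlonglongrightarrow> x" "vs \<longlonglongrightarrow> v"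
  shows "(\<lambda>k. chart_deriv c d h (xs k) (vs k)) \<longlonglongrightarrow> chart_deriv c d h x v"
  unfolding chart_deriv_def
  by (rule Ck_on_1_frechet_tendsto[OF Ck_on_chart open_chart_vimage])
    (use assms chart_tendsto[OF c] in auto)

end

lemma chart_deriv_chain:
  assumes g: "C1_map S g" and h: "C1_map S h"
    and c: "c \<in> atlas S" "x \<in> fst c" and d: "d \<in> atlas S" "h x \<in> fst d"
    and e: "e \<in> atlas S" "g (h x) \<in> fst e"
  shows "((snd e \<circ> (g \<circ> h) \<circ> chart_inv c) has_derivative
      (chart_deriv d e g (h x) \<circ> chart_deriv c d h x)) (at (snd c x))"
    and "chart_deriv c e (g \<circ> h) x v = chart_deriv d e g (h x) (chart_deriv c d h x v)"
proof -
  let ?G = "snd e \<circ> g \<circ> chart_inv d" and ?H = "snd d \<circ> h \<circ> chart_inv c"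
  have "(?G has_derivative chart_deriv d e g (h x)) (at (?H (snd c x)))"
    using chart_deriv[OF g d(1) e(1) d(2) e(2)] c by simp
  then have D: "(?G \<circ> ?H has_derivative (chart_deriv d e g (h x) \<circ> chart_deriv c d h x)) (at (snd c x))"
    using diff_chain_at[OF chart_deriv[OF h c(1) d(1) c(2) d(2)]] by blast
  \<comment> \<open>The two composites are known to agree only where \<open>h\<close> lands in the
    domain of \<open>d\<close>; that set is open, so the derivative carries over.\<close>
  show *: "((snd e \<circ> (g \<circ> h) \<circ> chart_inv c) has_derivative
      (chart_deriv d e g (h x) \<circ> chart_deriv c d h x)) (at (snd c x))"
    by (rule has_derivative_transform_within_open[OF D open_chart_vimage[OF h c(1) d(1)]])
      (use c d in auto)
  show "chart_deriv c e (g \<circ> h) x v = chart_deriv d e g (h x) (chart_deriv c d h x v)"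
    unfolding chart_deriv_def[of c e] using fun_cong[OF frechet_derivative_at[OF *], of v] by (metis o_apply)
qed

text \<open>The derivative of the composite factors through a chart around the intermediate point,
  and no such chart serves the whole domain. Along a sequence this is harmless: the chart around
  \<open>h x\<close>, for the limit point \<open>x\<close>, contains \<open>h (xs k)\<close> for all
  large \<open>k\<close>.\<close>

lemma C1_map_comp:
  assumes g: "C1_map S g" and h: "C1_map S h"
  shows "C1_map S (g \<circ> h)"
  unfolding C1_map_def
proof (intro conjI ballI)
  show "continuous_on UNIV (g \<circ> h)"
    using C1_map_continuous[OF g] C1_map_continuous[OF h]
    by (blast intro: continuous_on_compose continuous_on_subset)
next
  fix c e assume c: "c \<in> atlas S" and e: "e \<in> atlas S"
  let ?U = "snd c ` (fst c \<inter> (g \<circ> h) -` fst e)" and ?\<phi> = "snd e \<circ> (g \<circ> h) \<circ> chart_inv c"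
  have "?\<phi> differentiable (at z)" if z: "z \<in> ?U" for z
  proof -
    obtain x where "z = snd c x" "x \<in> fst c" "g (h x) \<in> fst e"
      using z by auto
    then show ?thesis
      unfolding differentiable_def using chart_deriv_chain(1)[OF g h c _ chart_at e] by blast
  qed
  moreover have "continuous_on ?U (\<lambda>z. frechet_derivative ?\<phi> (at z) b)" for b
    unfolding continuous_on_sequentially
  proof (intro allI ballI impI)
    fix zs z assume z: "z \<in> ?U" and zs: "(\<forall>n. zs n \<in> ?U) \<and> zs \<longlonglongrightarrow> z"
    define xs x where "xs = (\<lambda>k. chart_inv c (zs k))" and "x = chart_inv c z"
    have x: "x \<in> fst c" "g (h x) \<in> fst e" "snd c x = z"
      using z c by (auto simp: x_def)
    have xs': "xs k \<in> fst c" "g (h (xs k)) \<in> fst e" "snd c (xs k) = zs k" for k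
    proof -
      obtain x' where "zs k = snd c x'" "x' \<in> fst c" "g (h x') \<in> fst e"
        using conjunct1[OF zs, rule_format, of k] by auto
      then show "xs k \<in> fst c" "g (h (xs k)) \<in> fst e" "snd c (xs k) = zs k"
        using c by (auto simp: xs_def)
    qed
    have lim: "xs \<longlonglongrightarrow> x"
      unfolding xs_def using chart_inv_tendsto[OF c x(1), of zs sequentially] x(3) zs by auto
    define d where "d = chart_at S (h x)"
    have d: "d \<in> atlas S" "h x \<in> fst d"
      by (simp_all add: d_def)
    have ev: "eventually (\<lambda>k. h (xs k) \<in> fst d) sequentially"
      using C1_map_tendsto[OF h lim] open_chart(1)[OF d(1)] d(2) topological_tendstoD by blast
    have "(\<lambda>k. chart_deriv d e g (h (xs k)) (chart_deriv c d h (xs k) b))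
        \<longlonglongrightarrow> chart_deriv d e g (h x) (chart_deriv c d h x b)"
      using chart_deriv_tendsto[OF g d(1) e d(2) x(2) C1_map_tendsto[OF h lim]
          chart_deriv_tendsto[OF h c d(1) x(1) d(2) lim tendsto_const]] .
    then have "(\<lambda>k. chart_deriv d e g (h (xs k)) (chart_deriv c d h (xs k) b))
        \<longlonglongrightarrow> chart_deriv c e (g \<circ> h) x b"
      using chart_deriv_chain(2)[OF g h c x(1) d e x(2)] by simp
    moreover have "eventually (\<lambda>k. chart_deriv d e g (h (xs k)) (chart_deriv c d h (xs k) b) =
        chart_deriv c e (g \<circ> h) (xs k) b) sequentially"
      using ev by eventually_elim (use chart_deriv_chain(2)[OF g h c _ d(1) _ e] xs' in simp)
    ultimately have "(\<lambda>k. chart_deriv c e (g \<circ> h) (xs k) b) \<longlonglongrightarrow> chart_deriv c e (g \<circ> h) x b"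
      by (rule Lim_transform_eventually)
    then show "((\<lambda>z. frechet_derivative ?\<phi> (at z) b) \<circ> zs) \<longlonglongrightarrow> frechet_derivative ?\<phi> (at z) b"
      using x xs' by (simp add: chart_deriv_def o_def)
  qed
  ultimately show "Ck_on 1 ?\<phi> ?U"
    by simp
qed

lemma C1_map_funpow: "C1_map S h \<Longrightarrow> C1_map S (h ^^ n)"
  by (induction n) (auto simp: C1_map_comp C1_map_id)

section \<open>Coordinates of tangent vectors and of differentials\<close>

lemma to_coords_eq: "to_coords S c x = chart_deriv (chart_at S x) c id x"
  by (simp add: to_coords_def coord_change_def chart_deriv_def)

lemma of_coords_eq: "of_coords S c x = chart_deriv c (chart_at S x) id x"
  by (simp add: of_coords_def coord_change_def chart_deriv_def)

lemma differential_eq: "differential S h x = chart_deriv (chart_at S x) (chart_at S (h x)) h x"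
  by (simp add: differential_def chart_deriv_def)

lemma chart_deriv_id:
  assumes c: "c \<in> atlas S" "x \<in> fst c"
  shows "chart_deriv c c id x v = v"
proof -
  have "(snd c \<circ> id \<circ> chart_inv c has_derivative (\<lambda>v. v)) (at (snd c x))"
    by (rule has_derivative_transform_within_open[OF has_derivative_ident open_chart(2)[OF c(1)]])
      (use c in auto)
  then show ?thesis
    unfolding chart_deriv_def using frechet_derivative_at by metis
qed

lemma coord_change_chain:
  assumes "c \<in> atlas S" "x \<in> fst c" "d \<in> atlas S" "x \<in> fst d" "e \<in> atlas S" "x \<in> fst e"
  shows "chart_deriv d e id x (chart_deriv c d id x v) = chart_deriv c e id x v"
  using chart_deriv_chain(2)[OF C1_map_id C1_map_id assms(1,2,3) _ assms(5)] assms by simp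

lemma of_to_coords [simp]:
  assumes "c \<in> atlas S" "x \<in> fst c"
  shows "of_coords S c x (to_coords S c x v) = v" "to_coords S c x (of_coords S c x v) = v"
  by (simp_all add: of_coords_eq to_coords_eq coord_change_chain chart_deriv_id assms)

lemma to_coords_chart_at [simp]: "to_coords S (chart_at S x) x v = v"
  by (simp add: to_coords_eq chart_deriv_id)

lemma linear_coords:
  assumes "c \<in> atlas S" "x \<in> fst c"
  shows "linear (to_coords S c x)" "linear (of_coords S c x)"
  unfolding to_coords_eq of_coords_eq using assms
  by (auto intro!: has_derivative_linear[OF chart_deriv] C1_map_id)

lemma linear_differential: "C1_map S h \<Longrightarrow> linear (differential S h x)"
  unfolding differential_eq by (auto intro!: has_derivative_linear[OF chart_deriv])

lemma to_coords_differential: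
  assumes h: "C1_map S h" and c: "c \<in> atlas S" "x \<in> fst c" and d: "d \<in> atlas S" "h x \<in> fst d"
  shows "to_coords S d (h x) (differential S h x v) = chart_deriv c d h x (to_coords S c x v)"
  using chart_deriv_chain(2)[OF C1_map_id h chart_at chart_at d(1), of x v]
    chart_deriv_chain(2)[OF h C1_map_id chart_at c(1) _ d(1), of x v] c d
  by (simp add: to_coords_eq differential_eq)

lemma differential_comp:
  assumes "C1_map S g" "C1_map S h"
  shows "differential S (g \<circ> h) x v = differential S g (h x) (differential S h x v)"
  unfolding differential_eq
  using chart_deriv_chain(2)[OF assms chart_at chart_at chart_at(1), of x _ v] by simp

lemma differential_id [simp]: "differential S id x v = v"
  by (simp add: differential_eq chart_deriv_id)

end

section \<open>Lengths, areas and convergence of tangent vectors\<close>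

definition cross :: "real^2 \<Rightarrow> real^2 \<Rightarrow> real" where
  "cross v w = v$1 * w$2 - v$2 * w$1"

abbreviation e\<^sub>1 :: "real^2" where "e\<^sub>1 \<equiv> axis 1 1"
abbreviation e\<^sub>2 :: "real^2" where "e\<^sub>2 \<equiv> axis 2 1"

lemma real2_expand: "v = v$1 *\<^sub>R e\<^sub>1 + v$2 *\<^sub>R e\<^sub>2" for v :: "real^2"
  by (simp add: vec_eq_iff forall_2 axis_def)

lemma cross_linear:
  assumes "linear A"
  shows "cross (A v) (A w) = cross (A e\<^sub>1) (A e\<^sub>2) * cross v w"
proof -
  have A: "A u = u$1 *\<^sub>R A e\<^sub>1 + u$2 *\<^sub>R A e\<^sub>2" for u
    using assms by (subst real2_expand[of u]) (simp add: linear_add linear_scale)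
  show ?thesis
    by (simp add: A[of v] A[of w] cross_def algebra_simps)
qed

lemma cross_eq_0:
  assumes "cross v w = 0" "w \<noteq> 0"
  shows "\<exists>t. v = t *\<^sub>R w"
proof -
  consider "w$1 \<noteq> 0" | "w$2 \<noteq> 0"
    using assms(2) by (metis (mono_tags, lifting) exhaust_2 vec_eq_iff zero_index)
  then show ?thesis
  proof cases
    case 1
    then have "v = (v$1 / w$1) *\<^sub>R w"
      using assms(1) by (simp add: vec_eq_iff forall_2 cross_def field_simps)
    then show ?thesis ..
  next
    case 2
    then have "v = (v$2 / w$2) *\<^sub>R w"
      using assms(1) by (simp add: vec_eq_iff forall_2 cross_def field_simps)
    then show ?thesis ..
  qed
qed

text \<open>The area of the parallelogram spanned by the two vectors, as the root of their Gram
  determinant. For unit vectors it is the sine of their angle and measures how far they are from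
  being parallel.\<close>

definition area :: "'m riem_surface \<Rightarrow> 'm \<Rightarrow> real^2 \<Rightarrow> real^2 \<Rightarrow> real" where
  "area S x v w = sqrt (metric S x v v * metric S x w w - (metric S x v w)\<^sup>2)"

definition vol :: "'m riem_surface \<Rightarrow> 'm \<Rightarrow> real" where
  "vol S x = sqrt (metric S x e\<^sub>1 e\<^sub>1 * metric S x e\<^sub>2 e\<^sub>2 - (metric S x e\<^sub>1 e\<^sub>2)\<^sup>2)"

text \<open>The absolute value of the determinant of the differential with respect to the metrics.
  The coordinate determinant depends on the charts chosen at \<open>x\<close> and
  \<open>h x\<close>; the two factors \<open>vol\<close> correct this.\<close>

definition jac :: "'m riem_surface \<Rightarrow> ('m \<Rightarrow> 'm) \<Rightarrow> 'm \<Rightarrow> real" where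
  "jac S h x = vol S (h x) * \<bar>cross (differential S h x e\<^sub>1) (differential S h x e\<^sub>2)\<bar> / vol S x"

context surface
begin

section \<open>Linear algebra of the Riemannian inner product\<close>

lemma metric_bilinear: "bilinear (metric S x)"
  using surface by (simp add: riemannian_surface_def inner_product_def)

lemma metric_commute: "metric S x v w = metric S x w v"
  using surface by (simp add: riemannian_surface_def inner_product_def)

lemma metric_pos: "v \<noteq> 0 \<Longrightarrow> metric S x v v > 0"
  using surface by (simp add: riemannian_surface_def inner_product_def)

lemmas metric_simps [simp] =
  bilinear_ladd[OF metric_bilinear] bilinear_radd[OF metric_bilinear]
  bilinear_lmul[OF metric_bilinear] bilinear_rmul[OF metric_bilinear]
  bilinear_lsub[OF metric_bilinear] bilinear_rsub[OF metric_bilinear]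
  bilinear_lzero[OF metric_bilinear] bilinear_rzero[OF metric_bilinear]

lemma metric_nonneg [simp]: "metric S x v v \<ge> 0"
  using metric_pos[of v x] by (cases "v = 0") auto

lemma rnorm_nonneg [simp]: "rnorm S x v \<ge> 0"
  by (simp add: rnorm_def)

lemma rnorm_power2 [simp]: "(rnorm S x v)\<^sup>2 = metric S x v v"
  by (simp add: rnorm_def)

lemma rnorm_zero [simp]: "rnorm S x 0 = 0"
  by (simp add: rnorm_def)

lemma rnorm_pos [simp]: "rnorm S x v > 0 \<longleftrightarrow> v \<noteq> 0"
  using metric_pos[of v x] by (cases "v = 0") (auto simp: rnorm_def)

lemma rnorm_eq_0 [simp]: "rnorm S x v = 0 \<longleftrightarrow> v = 0"
  using metric_pos[of v x] by (cases "v = 0") (auto simp: rnorm_def)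

lemma rnorm_scaleR [simp]: "rnorm S x (t *\<^sub>R v) = \<bar>t\<bar> * rnorm S x v"
  by (simp add: rnorm_def real_sqrt_mult)

text \<open>The Gram matrix of two vectors is \<open>A^T G A\<close>, where \<open>G\<close> is the
  matrix of the metric and \<open>A\<close> has the vectors as columns; take determinants.\<close>

lemma gram_cross:
  "metric S x v v * metric S x w w - (metric S x v w)\<^sup>2 =
     (metric S x e\<^sub>1 e\<^sub>1 * metric S x e\<^sub>2 e\<^sub>2 - (metric S x e\<^sub>1 e\<^sub>2)\<^sup>2) * (cross v w)\<^sup>2"
proof -
  have m: "metric S x v w = v$1 * w$1 * metric S x e\<^sub>1 e\<^sub>1 +
      (v$1 * w$2 + v$2 * w$1) * metric S x e\<^sub>1 e\<^sub>2 + v$2 * w$2 * metric S x e\<^sub>2 e\<^sub>2" for v w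
    by (subst (1) real2_expand[of v], subst (1) real2_expand[of w])
      (simp add: metric_commute[of x e\<^sub>2 e\<^sub>1] algebra_simps)
  show ?thesis
    by (simp add: m[of v v] m[of w w] m[of v w] cross_def power2_eq_square algebra_simps)
qed

lemma gram_pos: "metric S x e\<^sub>1 e\<^sub>1 * metric S x e\<^sub>2 e\<^sub>2 - (metric S x e\<^sub>1 e\<^sub>2)\<^sup>2 > 0"
proof -
  define a b d where "a = metric S x e\<^sub>1 e\<^sub>1" and "b = metric S x e\<^sub>1 e\<^sub>2" and "d = metric S x e\<^sub>2 e\<^sub>2"
  \<comment> \<open>\<open>u\<close> is \<open>d\<close> times the component of
    \<open>e\<^sub>1\<close> orthogonal to \<open>e\<^sub>2\<close>, so its squared length is
    \<open>d\<close> times the Gram determinant.\<close>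
  define u where "u = d *\<^sub>R e\<^sub>1 - b *\<^sub>R e\<^sub>2"
  have d: "d > 0"
    unfolding d_def by (rule metric_pos) (simp add: axis_eq_0_iff)
  then have "u$1 \<noteq> 0"
    by (simp add: u_def axis_def)
  then have "0 < metric S x u u"
    by (intro metric_pos) auto
  also have "metric S x u u = d * (a * d - b\<^sup>2)"
    by (simp add: u_def metric_commute[of x e\<^sub>2 e\<^sub>1] power2_eq_square algebra_simps
        flip: a_def b_def d_def)
  finally show ?thesis
    using d by (simp add: zero_less_mult_iff a_def b_def d_def)
qed

lemma area_cross: "area S x v w = vol S x * \<bar>cross v w\<bar>"
  unfolding area_def gram_cross[of x v w] vol_def real_sqrt_mult by simp

lemma vol_pos [simp]: "vol S x > 0"
  using gram_pos by (simp add: vol_def)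

lemma area_nonneg [simp]: "area S x v w \<ge> 0"
  by (simp add: area_cross less_imp_le)

lemma area_power2: "(area S x v w)\<^sup>2 = metric S x v v * metric S x w w - (metric S x v w)\<^sup>2"
  using gram_pos[of x] unfolding area_def by (simp add: gram_cross[of x v w])

lemma area_le: "area S x v w \<le> rnorm S x v * rnorm S x w"
  by (rule power2_le_imp_le) (simp_all add: area_power2 power_mult_distrib)

text \<open>The square of \<open>area\<close> is exactly the defect in the squared
  inequality.\<close>

lemma Cauchy_Schwarz: "\<bar>metric S x v w\<bar> \<le> rnorm S x v * rnorm S x w"
proof (rule power2_le_imp_le)
  show "\<bar>metric S x v w\<bar>\<^sup>2 \<le> (rnorm S x v * rnorm S x w)\<^sup>2"
    using zero_le_power2[of "area S x v w"] by (simp add: area_power2 power_mult_distrib)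
qed simp

lemma rnorm_triangle: "rnorm S x (v + w) \<le> rnorm S x v + rnorm S x w"
proof (rule power2_le_imp_le)
  show "(rnorm S x (v + w))\<^sup>2 \<le> (rnorm S x v + rnorm S x w)\<^sup>2"
    using Cauchy_Schwarz[of x v w] by (simp add: power2_sum metric_commute[of x w v] abs_le_iff)
qed simp

lemma area_eq_0:
  assumes "area S x v w = 0" "w \<noteq> 0"
  shows "\<exists>t. v = t *\<^sub>R w"
  using assms vol_pos[of x] cross_eq_0 by (auto simp: area_cross)

lemma area_scaleR: "area S x (s *\<^sub>R v) (t *\<^sub>R w) = \<bar>s\<bar> * \<bar>t\<bar> * area S x v w"
proof -
  have "cross (s *\<^sub>R v) (t *\<^sub>R w) = s * t * cross v w"
    by (simp add: cross_def algebra_simps)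
  then show ?thesis
    by (simp add: area_cross abs_mult)
qed

lemma area_add_scaleR: "area S x (a *\<^sub>R v + b *\<^sub>R w) w = \<bar>a\<bar> * area S x v w"
proof -
  have "cross (a *\<^sub>R v + b *\<^sub>R w) w = a * cross v w"
    by (simp add: cross_def algebra_simps)
  then show ?thesis
    by (simp add: area_cross abs_mult)
qed

lemma unit_normal:
  assumes "rnorm S x v = 1"
  shows "rnorm S x (unit_normal S x v) = 1" "metric S x v (unit_normal S x v) = 0"
proof -
  \<comment> \<open>A witness for the choice in \<open>unit_normal\<close>: \<open>b\<close> is
    \<open>v\<close> turned by a right angle in coordinates, hence not parallel to \<open>v\<close>,
    and a Gram-Schmidt step makes it orthogonal for the metric.\<close>
  define b :: "real^2" where "b = vector [- (v$2), v$1]"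
  define w where "w = b - metric S x b v *\<^sub>R v"
  have v: "v \<noteq> 0" "metric S x v v = 1"
    using assms rnorm_power2[of x v] by auto
  have "cross v w = (v$1)\<^sup>2 + (v$2)\<^sup>2"
    by (simp add: w_def b_def cross_def power2_eq_square algebra_simps)
  moreover have "(v$1)\<^sup>2 + (v$2)\<^sup>2 \<noteq> 0"
    using v(1) by (simp add: sum_power2_eq_zero_iff vec_eq_iff forall_2)
  ultimately have w: "w \<noteq> 0"
    by (auto simp: cross_def)
  have "rnorm S x ((1 / rnorm S x w) *\<^sub>R w) = 1 \<and> metric S x v ((1 / rnorm S x w) *\<^sub>R w) = 0"
    using w v(2) by (simp add: w_def metric_commute[of x v b] flip: rnorm_pos)
  then have "rnorm S x (unit_normal S x v) = 1 \<and> metric S x v (unit_normal S x v) = 0"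
    unfolding unit_normal_def by (rule someI)
  then show "rnorm S x (unit_normal S x v) = 1" "metric S x v (unit_normal S x v) = 0"
    by auto
qed

lemma area_differential:
  assumes "C1_map S h"
  shows "area S (h x) (differential S h x v) (differential S h x w) = jac S h x * area S x v w"
  using less_imp_neq[OF vol_pos[of x]] cross_linear[OF linear_differential[OF assms], of x v w]
  by (simp add: area_cross jac_def abs_mult)

lemma jac_nonneg [simp]: "jac S h x \<ge> 0"
  by (simp add: jac_def less_imp_le)

lemma area_basis: "area S x e\<^sub>1 e\<^sub>2 = vol S x"
  by (simp add: area_cross cross_def axis_def)

lemma jac_comp:
  assumes "C1_map S g" "C1_map S h"
  shows "jac S (g \<circ> h) x = jac S g (h x) * jac S h x"
  using area_differential[OF assms(1), of "h x" "differential S h x e\<^sub>1" "differential S h x e\<^sub>2"]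
  by (simp add: jac_def[of S "g \<circ> h"] jac_def[of S h] differential_comp[OF assms] area_cross)

section \<open>Convergence of tangent vectors at varying base points\<close>

lemma tconv_lim: "tconv S xs vs y w \<Longrightarrow> xs \<longlonglongrightarrow> y"
  by (simp add: tconv_def)

lemma tconv_coords:
  "tconv S xs vs y w \<Longrightarrow> c \<in> atlas S \<Longrightarrow> y \<in> fst c \<Longrightarrow>
     (\<lambda>k. to_coords S c (xs k) (vs k)) \<longlonglongrightarrow> to_coords S c y w"
  by (simp add: tconv_def)

lemma eventually_in_chart:
  "xs \<longlonglongrightarrow> y \<Longrightarrow> c \<in> atlas S \<Longrightarrow> y \<in> fst c \<Longrightarrow> eventually (\<lambda>k. xs k \<in> fst c) sequentially"
  using open_chart(1) topological_tendstoD by blast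

text \<open>Coordinates in two charts around \<open>y\<close> differ by the derivative of a
  transition map, which depends continuously on the base point; convergence in one chart therefore
  passes to all others.\<close>

lemma tconvI:
  assumes xs: "xs \<longlonglongrightarrow> y" and c: "c \<in> atlas S" "y \<in> fst c"
    and vs: "(\<lambda>k. to_coords S c (xs k) (vs k)) \<longlonglongrightarrow> to_coords S c y w"
  shows "tconv S xs vs y w"
  unfolding tconv_def
proof (intro conjI ballI impI xs)
  fix d assume d: "d \<in> atlas S" "y \<in> fst d"
  have "(\<lambda>k. chart_deriv c d id (xs k) (to_coords S c (xs k) (vs k)))
      \<longlonglongrightarrow> chart_deriv c d id y (to_coords S c y w)"
    using chart_deriv_tendsto[OF C1_map_id c(1) d(1) c(2) _ xs vs] d by simp
  then have "(\<lambda>k. chart_deriv c d id (xs k) (to_coords S c (xs k) (vs k)))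
      \<longlonglongrightarrow> to_coords S d y w"
    by (simp add: to_coords_eq coord_change_chain c d)
  moreover have "eventually (\<lambda>k. chart_deriv c d id (xs k) (to_coords S c (xs k) (vs k)) =
      to_coords S d (xs k) (vs k)) sequentially"
    using eventually_in_chart[OF xs c] eventually_in_chart[OF xs d]
    by eventually_elim (simp add: to_coords_eq coord_change_chain c d)
  ultimately show "(\<lambda>k. to_coords S d (xs k) (vs k)) \<longlonglongrightarrow> to_coords S d y w"
    by (rule Lim_transform_eventually)
qed

lemma tconv_subseq:
  assumes "tconv S xs vs y w" "strict_mono r"
  shows "tconv S (\<lambda>k. xs (r k)) (\<lambda>k. vs (r k)) y w"
  unfolding tconv_def
proof (intro conjI ballI impI)
  show "(\<lambda>k. xs (r k)) \<longlonglongrightarrow> y"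
    using LIMSEQ_subseq_LIMSEQ[OF tconv_lim[OF assms(1)] assms(2)] by (simp add: o_def)
  show "(\<lambda>k. to_coords S c (xs (r k)) (vs (r k))) \<longlonglongrightarrow> to_coords S c y w"
    if "c \<in> atlas S" "y \<in> fst c" for c
    using LIMSEQ_subseq_LIMSEQ[OF tconv_coords[OF assms(1) that] assms(2)] by (simp add: o_def)
qed

lemma tconv_differential:
  assumes h: "C1_map S h" and t: "tconv S xs vs y w"
  shows "tconv S (\<lambda>k. h (xs k)) (\<lambda>k. differential S h (xs k) (vs k)) (h y) (differential S h y w)"
proof (rule tconvI[OF C1_map_tendsto[OF h tconv_lim[OF t]] chart_at])
  define c d where "c = chart_at S y" and "d = chart_at S (h y)"
  have c: "c \<in> atlas S" "y \<in> fst c" and d: "d \<in> atlas S" "h y \<in> fst d"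
    by (simp_all add: c_def d_def)
  have "(\<lambda>k. chart_deriv c d h (xs k) (to_coords S c (xs k) (vs k)))
      \<longlonglongrightarrow> chart_deriv c d h y (to_coords S c y w)"
    by (rule chart_deriv_tendsto[OF h c(1) d(1) c(2) d(2) tconv_lim[OF t] tconv_coords[OF t c]])
  then have "(\<lambda>k. chart_deriv c d h (xs k) (to_coords S c (xs k) (vs k)))
      \<longlonglongrightarrow> to_coords S d (h y) (differential S h y w)"
    by (simp add: to_coords_differential[OF h c d])
  moreover have "eventually (\<lambda>k. chart_deriv c d h (xs k) (to_coords S c (xs k) (vs k)) =
      to_coords S d (h (xs k)) (differential S h (xs k) (vs k))) sequentially"
    using eventually_in_chart[OF tconv_lim[OF t] c]
      eventually_in_chart[OF C1_map_tendsto[OF h tconv_lim[OF t]] d]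
    by eventually_elim (simp add: to_coords_differential[OF h c(1) _ d(1)])
  ultimately show "(\<lambda>k. to_coords S (chart_at S (h y)) (h (xs k)) (differential S h (xs k) (vs k)))
      \<longlonglongrightarrow> to_coords S (chart_at S (h y)) (h y) (differential S h y w)"
    unfolding d_def by (rule Lim_transform_eventually)
qed

lemma tconv_scaleR:
  assumes t: "tconv S xs vs y w" and a: "as \<longlonglongrightarrow> a"
  shows "tconv S xs (\<lambda>k. as k *\<^sub>R vs k) y (a *\<^sub>R w)"
proof (rule tconvI[OF tconv_lim[OF t] chart_at])
  let ?c = "chart_at S y"
  have "(\<lambda>k. as k *\<^sub>R to_coords S ?c (xs k) (vs k)) \<longlonglongrightarrow> a *\<^sub>R to_coords S ?c y w"
    by (intro tendsto_scaleR a tconv_coords[OF t chart_at])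
  then have "(\<lambda>k. as k *\<^sub>R to_coords S ?c (xs k) (vs k)) \<longlonglongrightarrow> to_coords S ?c y (a *\<^sub>R w)"
    by simp
  moreover have "eventually (\<lambda>k. as k *\<^sub>R to_coords S ?c (xs k) (vs k) =
      to_coords S ?c (xs k) (as k *\<^sub>R vs k)) sequentially"
    using eventually_in_chart[OF tconv_lim[OF t] chart_at]
    by eventually_elim (simp add: linear_scale[OF linear_coords(1)])
  ultimately show "(\<lambda>k. to_coords S ?c (xs k) (as k *\<^sub>R vs k)) \<longlonglongrightarrow> to_coords S ?c y (a *\<^sub>R w)"
    by (rule Lim_transform_eventually)
qed

text \<open>\<open>smooth_metric\<close> gives continuity in the base point for constant coordinate
  vectors; expanding in the basis lets the coordinates vary as well.\<close>

lemma metric_coords_tendsto: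
  assumes c: "c \<in> atlas S" "y \<in> fst c" and xs: "xs \<longlonglongrightarrow> y" and vs: "vs \<longlonglongrightarrow> v" and ws: "ws \<longlonglongrightarrow> w"
  shows "(\<lambda>k. metric S (xs k) (of_coords S c (xs k) (vs k)) (of_coords S c (xs k) (ws k)))
    \<longlonglongrightarrow> metric S y (of_coords S c y v) (of_coords S c y w)"
proof -
  define m where "m x a b = metric S x (of_coords S c x a) (of_coords S c x b)" for x a b
  have lim: "(\<lambda>k. m (xs k) a b) \<longlonglongrightarrow> m y a b" for a b
  proof -
    let ?\<phi> = "\<lambda>z. m (chart_inv c z) a b"
    have "continuous_on (snd c ` fst c) ?\<phi>"
    proof -
      have "smooth_on ?\<phi> (snd c ` fst c)"
        using surface c by (simp add: m_def riemannian_surface_def smooth_metric_def Let_def)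
      then have "Ck_on 0 ?\<phi> (snd c ` fst c)"
        unfolding smooth_on_def ..
      then show ?thesis
        by simp
    qed
    moreover have "eventually (\<lambda>k. snd c (xs k) \<in> snd c ` fst c) sequentially"
      using eventually_in_chart[OF xs c] by eventually_elim simp
    ultimately have "(\<lambda>k. ?\<phi> (snd c (xs k))) \<longlonglongrightarrow> ?\<phi> (snd c y)"
      using continuous_on_tendsto_compose[OF _ chart_tendsto[OF c xs]] c(2) by blast
    then have "(\<lambda>k. ?\<phi> (snd c (xs k))) \<longlonglongrightarrow> m y a b"
      using c by simp
    moreover have "eventually (\<lambda>k. ?\<phi> (snd c (xs k)) = m (xs k) a b) sequentially"
      using eventually_in_chart[OF xs c] by eventually_elim (simp add: c)
    ultimately show ?thesis
      by (rule Lim_transform_eventually)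
  qed
  have expand: "m x v w = v$1 * w$1 * m x e\<^sub>1 e\<^sub>1 + v$1 * w$2 * m x e\<^sub>1 e\<^sub>2 +
      v$2 * w$1 * m x e\<^sub>2 e\<^sub>1 + v$2 * w$2 * m x e\<^sub>2 e\<^sub>2" if "x \<in> fst c" for x v w
  proof -
    have "of_coords S c x v = v$1 *\<^sub>R of_coords S c x e\<^sub>1 + v$2 *\<^sub>R of_coords S c x e\<^sub>2" for v
      using linear_coords(2)[OF c(1) that]
      by (subst real2_expand[of v]) (simp add: linear_add linear_scale)
    from this[of v] this[of w] show ?thesis
      unfolding m_def by (simp add: algebra_simps)
  qed
  have "(\<lambda>k. vs k$1 * ws k$1 * m (xs k) e\<^sub>1 e\<^sub>1 + vs k$1 * ws k$2 * m (xs k) e\<^sub>1 e\<^sub>2 +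
      vs k$2 * ws k$1 * m (xs k) e\<^sub>2 e\<^sub>1 + vs k$2 * ws k$2 * m (xs k) e\<^sub>2 e\<^sub>2) \<longlonglongrightarrow> m y v w"
    unfolding expand[OF c(2), of v w]
    by (intro tendsto_intros tendsto_vec_nth vs ws lim)
  moreover have "eventually (\<lambda>k. vs k$1 * ws k$1 * m (xs k) e\<^sub>1 e\<^sub>1 + vs k$1 * ws k$2 * m (xs k) e\<^sub>1 e\<^sub>2 +
      vs k$2 * ws k$1 * m (xs k) e\<^sub>2 e\<^sub>1 + vs k$2 * ws k$2 * m (xs k) e\<^sub>2 e\<^sub>2 =
      m (xs k) (vs k) (ws k)) sequentially"
    using eventually_in_chart[OF xs c] by eventually_elim (rule expand[symmetric])
  ultimately have "(\<lambda>k. m (xs k) (vs k) (ws k)) \<longlonglongrightarrow> m y v w"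
    by (rule Lim_transform_eventually)
  then show ?thesis
    by (simp add: m_def)
qed

lemma of_coords_chart_at [simp]: "of_coords S (chart_at S x) x v = v"
  by (simp add: of_coords_eq chart_deriv_id)

lemma tconv_metric:
  assumes v: "tconv S xs vs y v" and w: "tconv S xs ws y w"
  shows "(\<lambda>k. metric S (xs k) (vs k) (ws k)) \<longlonglongrightarrow> metric S y v w"
proof -
  let ?c = "chart_at S y"
  let ?m = "\<lambda>x a b. metric S x (of_coords S ?c x (to_coords S ?c x a)) (of_coords S ?c x (to_coords S ?c x b))"
  have "(\<lambda>k. ?m (xs k) (vs k) (ws k)) \<longlonglongrightarrow> ?m y v w"
    by (rule metric_coords_tendsto[OF chart_at tconv_lim[OF v]
          tconv_coords[OF v chart_at] tconv_coords[OF w chart_at]])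
  then have "(\<lambda>k. ?m (xs k) (vs k) (ws k)) \<longlonglongrightarrow> metric S y v w"
    by simp
  then show ?thesis
    by (rule Lim_transform_eventually)
      (use eventually_in_chart[OF tconv_lim[OF v] chart_at] in eventually_elim, simp)
qed

lemma tconv_rnorm: "tconv S xs vs y v \<Longrightarrow> (\<lambda>k. rnorm S (xs k) (vs k)) \<longlonglongrightarrow> rnorm S y v"
  unfolding rnorm_def by (intro tendsto_real_sqrt tconv_metric)

lemma tconv_area:
  "tconv S xs vs y v \<Longrightarrow> tconv S xs ws y w \<Longrightarrow>
     (\<lambda>k. area S (xs k) (vs k) (ws k)) \<longlonglongrightarrow> area S y v w"
  unfolding area_def by (intro tendsto_intros tconv_metric)

lemma tconv_extend:
  assumes xs: "xs \<longlonglongrightarrow> y"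
  obtains vs where "tconv S xs vs y v"
proof -
  let ?c = "chart_at S y"
  let ?vs = "\<lambda>k. of_coords S ?c (xs k) v"
  have "tconv S xs ?vs y v"
  proof (rule tconvI[OF xs chart_at])
    show "(\<lambda>k. to_coords S ?c (xs k) (?vs k)) \<longlonglongrightarrow> to_coords S ?c y v"
      by (rule tendsto_eventually)
        (use eventually_in_chart[OF xs chart_at] in eventually_elim, simp)
  qed
  then show ?thesis ..
qed

text \<open>The factors in the definition of \<open>jac\<close> are computed in the chart chosen at
  each \<open>xs k\<close> and need not converge one by one. The ratio between the area of the image
  of a convergent frame and the area of the frame does not depend on that choice.\<close>

lemma jac_tendsto:
  assumes h: "C1_map S h" and xs: "xs \<longlonglongrightarrow> y"
  shows "(\<lambda>k. jac S h (xs k)) \<longlonglongrightarrow> jac S h y"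
proof -
  obtain us vs where u: "tconv S xs us y e\<^sub>1" and v: "tconv S xs vs y e\<^sub>2"
    using tconv_extend[OF xs] by metis
  let ?n = "\<lambda>k. area S (h (xs k)) (differential S h (xs k) (us k)) (differential S h (xs k) (vs k))"
  have "(\<lambda>k. ?n k / area S (xs k) (us k) (vs k)) \<longlonglongrightarrow> jac S h y"
    unfolding jac_def area_basis[symmetric, of y] area_cross[symmetric]
    by (intro tendsto_divide tconv_area tconv_differential h u v) (simp add: area_basis less_imp_neq[THEN not_sym])
  moreover have "eventually (\<lambda>k. area S (xs k) (us k) (vs k) > 0) sequentially"
    using order_tendstoD(1)[OF tconv_area[OF u v]] by (simp add: area_basis)
  then have "eventually (\<lambda>k. ?n k / area S (xs k) (us k) (vs k) = jac S h (xs k)) sequentially"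
    by eventually_elim (simp add: area_differential[OF h])
  ultimately show ?thesis
    by (rule Lim_transform_eventually)
qed

text \<open>At the outset no bound is known for the coordinates of the vectors in a chart around the
  limit of the base points. So their Euclidean directions are made to converge, and the metric,
  whose limit on them is positive, restores the lengths.\<close>

lemma unit_vectors_compact:
  fixes xs :: "nat \<Rightarrow> 'm"
  assumes comp: "compact (UNIV :: 'm set)" and unit: "\<And>k. rnorm S (xs k) (vs k) = 1"
  obtains r y w where "strict_mono r" "tconv S (\<lambda>k. xs (r k)) (\<lambda>k. vs (r k)) y w" "rnorm S y w = 1"
proof -
  obtain y r1 where r1: "strict_mono r1" and lim1: "(\<lambda>k. xs (r1 k)) \<longlonglongrightarrow> y"
    using comp[unfolded compact_def, rule_format, of xs] by (auto simp: o_def)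
  define c where "c = chart_at S y"
  have c: "c \<in> atlas S" "y \<in> fst c"
    by (simp_all add: c_def)
  define z where "z k = to_coords S c (xs (r1 k)) (vs (r1 k))" for k
  have "\<forall>k. sgn (z k) \<in> cball 0 1"
    by (simp add: norm_sgn)
  then obtain \<zeta> r2 where r2: "strict_mono r2" and "((\<lambda>k. sgn (z k)) \<circ> r2) \<longlonglongrightarrow> \<zeta>"
    using compact_cball[of "0::real^2" 1, unfolded compact_def, rule_format, of "\<lambda>k. sgn (z k)"] by blast
  then have lim2: "(\<lambda>k. sgn (z (r2 k))) \<longlonglongrightarrow> \<zeta>"
    by (simp add: o_def)
  define r where "r = r1 \<circ> r2"
  have r: "strict_mono r"
    using r1 r2 by (simp add: r_def strict_mono_o)
  have lim: "(\<lambda>k. xs (r k)) \<longlonglongrightarrow> y"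
    using LIMSEQ_subseq_LIMSEQ[OF lim1 r2] by (simp add: r_def o_def)
  define Z where "Z k = to_coords S c (xs (r k)) (vs (r k))" for k
  have lim2: "(\<lambda>k. sgn (Z k)) \<longlonglongrightarrow> \<zeta>"
    using lim2 by (simp add: Z_def z_def r_def)
  have in_c: "eventually (\<lambda>k. xs (r k) \<in> fst c) sequentially"
    by (rule eventually_in_chart[OF lim c])
  define q where "q = metric S y (of_coords S c y \<zeta>) (of_coords S c y \<zeta>)"
  let ?q = "\<lambda>k. metric S (xs (r k)) (of_coords S c (xs (r k)) (sgn (Z k))) (of_coords S c (xs (r k)) (sgn (Z k)))"
  have q_lim: "?q \<longlonglongrightarrow> q"
    unfolding q_def by (rule metric_coords_tendsto[OF c lim lim2 lim2])
  have ev: "eventually (\<lambda>k. Z k \<noteq> 0 \<and> ?q k = (1 / norm (Z k))\<^sup>2) sequentially"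
    using in_c
  proof eventually_elim
    case (elim k)
    let ?x = "xs (r k)" and ?v = "vs (r k)"
    have v: "of_coords S c ?x (Z k) = ?v"
      using c elim by (simp add: Z_def)
    have 1: "metric S ?x ?v ?v = 1"
      using unit[of "r k"] rnorm_power2[of ?x ?v] by simp
    have "Z k \<noteq> 0"
      using v 1 linear_0[OF linear_coords(2)[OF c(1) elim]] by auto
    moreover have "of_coords S c ?x (sgn (Z k)) = (1 / norm (Z k)) *\<^sub>R ?v"
      using linear_scale[OF linear_coords(2)[OF c(1) elim]] v by (simp add: sgn_div_norm divide_inverse)
    ultimately show ?case
      using 1 by (simp add: power2_eq_square)
  qed
  have "norm \<zeta> = 1"
  proof (rule tendsto_unique[OF _ tendsto_norm[OF lim2]])
    show "(\<lambda>k. norm (sgn (Z k))) \<longlonglongrightarrow> 1"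
      by (rule tendsto_eventually) (use ev in eventually_elim, simp add: norm_sgn)
  qed simp
  then have "\<zeta> \<noteq> 0"
    by auto
  then have "of_coords S c y \<zeta> \<noteq> 0"
    using of_to_coords(2)[OF c, of \<zeta>] linear_0[OF linear_coords(1)[OF c]] by metis
  then have q: "q > 0"
    unfolding q_def by (rule metric_pos)
  have "(\<lambda>k. inverse (sqrt (?q k)) *\<^sub>R sgn (Z k)) \<longlonglongrightarrow> inverse (sqrt q) *\<^sub>R \<zeta>"
    using q by (intro tendsto_intros q_lim lim2) simp
  \<comment> \<open>As \<open>vs (r k)\<close> has length 1, the metric length of
    \<open>sgn (Z k)\<close> is the reciprocal of \<open>norm (Z k)\<close>; dividing by it recovers
    \<open>Z k\<close>.\<close>
  moreover have "eventually (\<lambda>k. inverse (sqrt (?q k)) *\<^sub>R sgn (Z k) = Z k) sequentially"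
    using ev
  proof eventually_elim
    case (elim k)
    then have "sqrt (?q k) = 1 / norm (Z k)"
      by (simp only: real_sqrt_abs) simp
    then show ?case
      using elim by (simp add: sgn_div_norm)
  qed
  ultimately have "Z \<longlonglongrightarrow> inverse (sqrt q) *\<^sub>R \<zeta>"
    by (rule Lim_transform_eventually)
  then have t: "tconv S (\<lambda>k. xs (r k)) (\<lambda>k. vs (r k)) y (of_coords S c y (inverse (sqrt q) *\<^sub>R \<zeta>))"
    (is "tconv S _ _ y ?w") by (intro tconvI[OF lim c]) (simp add: c Z_def[abs_def])
  moreover have "rnorm S y ?w = 1"
    using tendsto_unique[OF _ tconv_rnorm[OF t], of 1] unit by simp
  ultimately show ?thesis
    using that r by blast
qed

end

section \<open>The projective cocycle\<close>

text \<open>The fibre part of the projective cocycle, for an arbitrary map: the \<open>n\<close>-th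
  iterate of the cocycle is then \<open>dir\<close> of the single map \<open>h ^^ n\<close>.\<close>

definition dir :: "'m riem_surface \<Rightarrow> ('m \<Rightarrow> 'm) \<Rightarrow> 'm \<Rightarrow> real^2 \<Rightarrow> real^2" where
  "dir S h x v = differential S h x v /\<^sub>R rnorm S (h x) (differential S h x v)"

text \<open>The factor \<open>g(v)\<close> for unit vectors \<open>v\<close>.\<close>

definition dir_deriv :: "'m riem_surface \<Rightarrow> ('m \<Rightarrow> 'm) \<Rightarrow> 'm \<Rightarrow> real^2 \<Rightarrow> real" where
  "dir_deriv S h x v = jac S h x / (rnorm S (h x) (differential S h x v))\<^sup>2"

lemma C1_diffeo_inv: "C1_diffeo S h \<Longrightarrow> C1_diffeo S (inv h)"
  by (simp add: C1_diffeo_def bij_imp_bij_inv inv_inv_eq)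

lemma C1_diffeo_bij: "C1_diffeo S h \<Longrightarrow> bij h"
  by (simp add: C1_diffeo_def)

lemma C1_diffeo_map: "C1_diffeo S h \<Longrightarrow> C1_map S h"
  by (simp add: C1_diffeo_def)

lemma bij_inv_apply [simp]:
  assumes "bij h"
  shows "inv h (h x) = x" "h (inv h x) = x"
  using assms by (simp_all add: bij_is_inj bij_is_surj surj_f_inv_f)

lemma funpow_inv_cancel:
  assumes "bij h"
  shows "(inv h ^^ n) ((h ^^ n) x) = x" "(h ^^ n) ((inv h ^^ n) x) = x"
  using bij_inv_apply[OF bij_fn[OF assms, of n]] by (simp_all add: inv_fn[OF assms])

lemma funpow_inv_diff:
  assumes "bij h" "j \<le> m"
  shows "(inv h ^^ j) ((h ^^ m) x) = (h ^^ (m - j)) x"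
proof -
  have "(h ^^ m) x = (h ^^ j) ((h ^^ (m - j)) x)"
    using assms(2) by (simp flip: funpow_add comp_apply[of "h ^^ j"])
  then show ?thesis
    by (simp add: funpow_inv_cancel[OF assms(1)])
qed

lemma point_iter_nat: "point_iter f (int n) = f ^^ n" "point_iter f (- int n) = inv f ^^ n"
  by (simp add: iter_def, cases "n = 0") (simp_all add: iter_def)

context surface
begin

lemma C1_diffeo_funpow:
  assumes "C1_diffeo S h"
  shows "C1_diffeo S (h ^^ n)"
  using assms by (simp add: C1_diffeo_def bij_fn inv_fn C1_map_funpow)

lemma differential_inv:
  assumes "C1_diffeo S h"
  shows "differential S (inv h) (h x) (differential S h x v) = v"
    and "differential S h (inv h x) (differential S (inv h) x v) = v"
proof -
  have *: "inv h \<circ> h = id" "h \<circ> inv h = id"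
    using assms by (auto simp: C1_diffeo_def fun_eq_iff)
  show "differential S (inv h) (h x) (differential S h x v) = v"
    using assms differential_comp[of "inv h" h x v] by (simp add: C1_diffeo_def *)
  show "differential S h (inv h x) (differential S (inv h) x v) = v"
    using assms differential_comp[of h "inv h" x v] by (simp add: C1_diffeo_def *)
qed

lemma differential_eq_0 [simp]:
  assumes "C1_diffeo S h"
  shows "differential S h x v = 0 \<longleftrightarrow> v = 0"
  using differential_inv(1)[OF assms, of x v] linear_0[OF linear_differential]
    assms C1_diffeo_inv[OF assms] C1_diffeo_map by metis

lemma rnorm_dir [simp]:
  assumes "C1_diffeo S h" "v \<noteq> 0"
  shows "rnorm S (h x) (dir S h x v) = 1"
proof -
  have "rnorm S (h x) (differential S h x v) \<noteq> 0"
    using assms by simp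
  then show ?thesis
    by (simp add: dir_def)
qed

lemma unit_nonzero: "rnorm S x v = 1 \<Longrightarrow> v \<noteq> 0"
  by auto

lemma dir_id: "rnorm S x v = 1 \<Longrightarrow> dir S id x v = v"
  by (simp add: dir_def)

lemma dir_comp:
  assumes g: "C1_diffeo S g" and h: "C1_diffeo S h" and v: "v \<noteq> 0"
  shows "dir S (g \<circ> h) x v = dir S g (h x) (dir S h x v)"
proof -
  have "rnorm S (h x) (differential S h x v) > 0"
    using h v by simp
  then show ?thesis
    using linear_scale[OF linear_differential[OF C1_diffeo_map[OF g]]]
    by (simp add: dir_def differential_comp[OF C1_diffeo_map[OF g] C1_diffeo_map[OF h]])
qed

lemma dir_deriv_comp:
  assumes g: "C1_diffeo S g" and h: "C1_diffeo S h" and v: "v \<noteq> 0"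
  shows "dir_deriv S (g \<circ> h) x v = dir_deriv S g (h x) (dir S h x v) * dir_deriv S h x v"
proof -
  have "rnorm S (h x) (differential S h x v) > 0"
    using h v by simp
  then show ?thesis
    using linear_scale[OF linear_differential[OF C1_diffeo_map[OF g]]]
    by (simp add: dir_def dir_deriv_def differential_comp[OF C1_diffeo_map[OF g] C1_diffeo_map[OF h]]
        jac_comp[OF C1_diffeo_map[OF g] C1_diffeo_map[OF h]] power_mult_distrib field_simps
        del: rnorm_power2)
qed

lemma dir_deriv_nonneg [simp]: "dir_deriv S h x v \<ge> 0"
  by (simp add: dir_deriv_def)

lemma tconv_dir:
  assumes h: "C1_diffeo S h" and t: "tconv S xs vs y w" and w: "w \<noteq> 0"
  shows "tconv S (\<lambda>k. h (xs k)) (\<lambda>k. dir S h (xs k) (vs k)) (h y) (dir S h y w)"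
proof -
  note D = tconv_differential[OF C1_diffeo_map[OF h] t]
  have "rnorm S (h y) (differential S h y w) \<noteq> 0"
    using h w by simp
  then show ?thesis
    unfolding dir_def by (intro tconv_scaleR D tendsto_inverse tconv_rnorm[OF D])
qed

lemma dir_deriv_tendsto:
  assumes h: "C1_diffeo S h" and t: "tconv S xs vs y w" and w: "w \<noteq> 0"
  shows "(\<lambda>k. dir_deriv S h (xs k) (vs k)) \<longlonglongrightarrow> dir_deriv S h y w"
proof -
  note D = tconv_differential[OF C1_diffeo_map[OF h] t]
  have "rnorm S (h y) (differential S h y w) \<noteq> 0"
    using h w by simp
  then show ?thesis
    unfolding dir_deriv_def
    by (intro tendsto_divide jac_tendsto[OF C1_diffeo_map[OF h] tconv_lim[OF t]]
        tendsto_power tconv_rnorm[OF D]) (simp del: rnorm_power2)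
qed

lemma rnorm_circle:
  assumes "rnorm S x v = 1" "rnorm S x w = 1" "metric S x v w = 0"
  shows "rnorm S x (cos t *\<^sub>R v + sin t *\<^sub>R w) = 1"
proof -
  have "metric S x v v = 1" "metric S x w w = 1"
    using assms rnorm_power2[of x v] rnorm_power2[of x w] by auto
  then show ?thesis
    using assms(3) metric_commute[of x w v] sin_cos_squared_add[of t]
    by (simp add: rnorm_def power2_eq_square add.commute)
qed

text \<open>Normalising a curve of vectors keeps only the part of its velocity orthogonal to the
  vector, divided by the length. The squared norm of the result is the Gram determinant of the
  images of the orthonormal pair \<open>v\<close>, \<open>w\<close>, which is the square of
  \<open>jac\<close>, over the fourth power of the length of the image of \<open>v\<close>.\<close>

lemma dir_deriv_circle:
  assumes h: "C1_diffeo S h" and v: "rnorm S x v = 1" and w: "rnorm S x w = 1" "metric S x v w = 0"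
  shows "rnorm S (h x) (vector_derivative (\<lambda>t. dir S h x (cos t *\<^sub>R v + sin t *\<^sub>R w)) (at 0)) =
    dir_deriv S h x v"
proof -
  define a b where "a = differential S h x v" and "b = differential S h x w"
  define A B C where "A = metric S (h x) a a" and "B = metric S (h x) a b" and "C = metric S (h x) b b"
  have A: "A > 0"
    using h unit_nonzero[OF v] by (simp add: A_def a_def metric_pos)
  define q where "q t = (cos t)\<^sup>2 * A + 2 * cos t * sin t * B + (sin t)\<^sup>2 * C" for t
  have lin: "differential S h x (cos t *\<^sub>R v + sin t *\<^sub>R w) = cos t *\<^sub>R a + sin t *\<^sub>R b" for t
    using linear_differential[OF C1_diffeo_map[OF h], of x]
    by (simp add: a_def b_def linear_add linear_scale)
  have "metric S (h x) (cos t *\<^sub>R a + sin t *\<^sub>R b) (cos t *\<^sub>R a + sin t *\<^sub>R b) = q t" for t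
    by (simp add: q_def A_def B_def C_def metric_commute[of "h x" b a] power2_eq_square algebra_simps)
  then have dir: "dir S h x (cos t *\<^sub>R v + sin t *\<^sub>R w) = inverse (sqrt (q t)) *\<^sub>R (cos t *\<^sub>R a + sin t *\<^sub>R b)" for t
    by (simp add: dir_def lin rnorm_def)
  \<comment> \<open>The component of \<open>b\<close> orthogonal to \<open>a\<close>, divided by the
    length \<open>sqrt A\<close> of \<open>a\<close>.\<close>
  define D where "D = inverse (sqrt A) *\<^sub>R b + (- B / (A * sqrt A)) *\<^sub>R a"
  have "(q has_field_derivative 2 * B) (at 0)"
    unfolding q_def by (auto intro!: derivative_eq_intros)
  moreover have q0: "q 0 = A"
    by (simp add: q_def)
  ultimately have "((\<lambda>t. inverse (sqrt (q t))) has_field_derivative (- B / (A * sqrt A))) (at 0)"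
    using A by (auto intro!: derivative_eq_intros simp: field_simps)
  moreover have "((\<lambda>t. cos t *\<^sub>R a + sin t *\<^sub>R b) has_vector_derivative b) (at 0)"
    by (auto intro!: derivative_eq_intros)
  ultimately have "((\<lambda>t. inverse (sqrt (q t)) *\<^sub>R (cos t *\<^sub>R a + sin t *\<^sub>R b)) has_vector_derivative D) (at 0)"
    using has_vector_derivative_scaleR[of "\<lambda>t. inverse (sqrt (q t))" _ 0 UNIV] by (fastforce simp: D_def q0)
  then have "vector_derivative (\<lambda>t. dir S h x (cos t *\<^sub>R v + sin t *\<^sub>R w)) (at 0) = D"
    unfolding dir by (rule vector_derivative_at)
  moreover have "rnorm S (h x) D = dir_deriv S h x v"
  proof (rule power2_eq_imp_eq)
    have "area S x v w = 1"
      using v w by (simp add: area_def rnorm_def)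
    then have "(jac S h x)\<^sup>2 = A * C - B\<^sup>2"
      using area_differential[OF C1_diffeo_map[OF h], of x v w] area_power2[of "h x" a b]
      by (simp add: a_def b_def A_def B_def C_def)
    moreover have "(rnorm S (h x) D)\<^sup>2 = (A * C - B\<^sup>2) / A\<^sup>2"
    proof -
      define s where "s = sqrt A"
      have s: "s > 0" "A = s\<^sup>2"
        using A by (simp_all add: s_def)
      have "metric S (h x) D D = inverse s * inverse s * C + 2 * inverse s * (- B / (A * s)) * B +
          (- B / (A * s)) * (- B / (A * s)) * A"
        by (simp add: D_def A_def B_def C_def metric_commute[of "h x" b a] s_def algebra_simps)
      also have "\<dots> = (A * C - B\<^sup>2) / A\<^sup>2"
        using s(1) by (simp add: s(2) field_simps power2_eq_square)
      finally show ?thesis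
        by simp
    qed
    ultimately show "(rnorm S (h x) D)\<^sup>2 = (dir_deriv S h x v)\<^sup>2"
      by (simp add: dir_deriv_def power_divide flip: a_def A_def)
  qed simp_all
  ultimately show ?thesis
    by simp
qed

section \<open>Iterates of the projective cocycle\<close>

lemma proj_cocycle_dir: "proj_cocycle S h (x, v) = (h x, dir S h x v)"
  by (simp add: proj_cocycle_def dir_def)

lemma proj_cocycle_unit_bundle:
  "C1_diffeo S h \<Longrightarrow> p \<in> unit_bundle S \<Longrightarrow> proj_cocycle S h p \<in> unit_bundle S"
  by (auto simp: unit_bundle_def unit_vectors_def proj_cocycle_dir unit_nonzero)

lemma proj_cocycle_inv:
  assumes "C1_diffeo S h" "p \<in> unit_bundle S"
  shows "proj_cocycle S (inv h) (proj_cocycle S h p) = p"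
proof -
  obtain x v where p: "p = (x, v)" and v: "rnorm S x v = 1"
    using assms(2) by (auto simp: unit_bundle_def unit_vectors_def)
  have "inv h \<circ> h = id"
    using C1_diffeo_bij[OF assms(1)] by (auto simp: fun_eq_iff)
  then show ?thesis
    using dir_comp[OF C1_diffeo_inv[OF assms(1)] assms(1) unit_nonzero[OF v], of x]
      C1_diffeo_bij[OF assms(1)] by (simp add: p proj_cocycle_dir dir_id v)
qed

text \<open>Negative orders of \<open>iter\<close> use the inverse within the unit bundle. There
  normalisation loses nothing, so the cocycle of \<open>inv h\<close> undoes that of
  \<open>h\<close>, and negative iterates become positive iterates of the inverse map.\<close>

lemma inv_proj_cocycle:
  assumes "C1_diffeo S h" "p \<in> unit_bundle S"
  shows "inv_into (unit_bundle S) (proj_cocycle S h) p = proj_cocycle S (inv h) p"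
proof (rule inv_into_f_eq)
  show "inj_on (proj_cocycle S h) (unit_bundle S)"
    by (rule inj_on_inverseI) (rule proj_cocycle_inv[OF assms(1)])
  show "proj_cocycle S (inv h) p \<in> unit_bundle S"
    by (rule proj_cocycle_unit_bundle[OF C1_diffeo_inv[OF assms(1)] assms(2)])
  show "proj_cocycle S h (proj_cocycle S (inv h) p) = p"
    using proj_cocycle_inv[OF C1_diffeo_inv[OF assms(1)] assms(2)] C1_diffeo_bij[OF assms(1)]
    by (simp add: inv_inv_eq)
qed

lemma proj_cocycle_funpow:
  assumes h: "C1_diffeo S h" and v: "rnorm S x v = 1"
  shows "(proj_cocycle S h ^^ n) (x, v) = ((h ^^ n) x, dir S (h ^^ n) x v)"
proof (induction n)
  case 0
  then show ?case
    using dir_id[OF v] by (simp add: id_def)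
next
  case (Suc n)
  then show ?case
    using dir_comp[OF h C1_diffeo_funpow[OF h] unit_nonzero[OF v]] by (simp add: proj_cocycle_dir o_def)
qed

lemma inv_proj_cocycle_funpow:
  assumes h: "C1_diffeo S h" and p: "p \<in> unit_bundle S"
  shows "(inv_into (unit_bundle S) (proj_cocycle S h) ^^ n) p = (proj_cocycle S (inv h) ^^ n) p"
proof -
  have "(proj_cocycle S (inv h) ^^ n) p \<in> unit_bundle S" for n
    by (induction n) (simp_all add: p proj_cocycle_unit_bundle C1_diffeo_inv[OF h])
  then show ?thesis
    by (induction n) (simp_all add: inv_proj_cocycle[OF h])
qed

lemma proj_iter_nat:
  assumes h: "C1_diffeo S h" and v: "rnorm S x v = 1"
  shows "proj_iter S h (int n) x v = dir S (h ^^ n) x v"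
    and "proj_iter S h (- int n) x v = dir S (inv h ^^ n) x v"
proof -
  show *: "proj_iter S h (int n) x v = dir S (h ^^ n) x v" for n
    by (simp add: proj_iter_def iter_def proj_cocycle_funpow[OF h v])
  have "(x, v) \<in> unit_bundle S"
    using v by (simp add: unit_bundle_def unit_vectors_def)
  \<comment> \<open>For \<open>n = 0\<close> the order \<open>- int n\<close> falls into the
    nonnegative branch of \<open>iter\<close>, hence the case distinction.\<close>
  then show "proj_iter S h (- int n) x v = dir S (inv h ^^ n) x v"
    using *[of 0] inv_proj_cocycle_funpow[OF h] proj_cocycle_funpow[OF C1_diffeo_inv[OF h] v]
    by (cases "n = 0") (simp_all add: proj_iter_def iter_def)
qed

lemma proj_deriv_nat:
  assumes h: "C1_diffeo S h" and v: "rnorm S x v = 1"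
  shows "proj_deriv S h (int n) x v = dir_deriv S (h ^^ n) x v"
    and "proj_deriv S h (- int n) x v = dir_deriv S (inv h ^^ n) x v"
  unfolding proj_deriv_def proj_iter_nat[OF h rnorm_circle[OF v unit_normal[OF v]]] point_iter_nat
  using dir_deriv_circle[OF C1_diffeo_funpow v unit_normal[OF v]] h C1_diffeo_inv[OF h] by auto

text \<open>The point of \<open>K\<close> required by \<open>slope_less\<close> is the limit
  \<open>y\<close> itself. The identified vectors all lie in the one tangent space at
  \<open>y\<close>, where they converge to \<open>u\<close>, so their angle with \<open>u\<close>
  tends to 0.\<close>

lemma slope_less_eventually:
  assumes Q: "local_coordinates S Q" and t: "tconv S xs vs y u"
    and y: "y \<in> K" and u: "u \<in> L y" "u \<noteq> 0" and \<epsilon>: "\<epsilon> > 0"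
  shows "eventually (\<lambda>k. slope_less S Q K (xs k) (vs k) L \<epsilon>) sequentially"
proof -
  have fin: "finite Q" and sub: "Q \<subseteq> atlas S" and cover: "(\<Union>c\<in>Q. fst c) = UNIV"
    using Q by (auto simp: local_coordinates_def)
  obtain c0 where c0: "c0 \<in> Q" "y \<in> fst c0"
    using cover by blast
  have angle: "eventually (\<lambda>k. line_angle S y (identify S c (xs k) y (vs k)) u < \<epsilon>) sequentially"
    if c: "c \<in> Q" "y \<in> fst c" for c
  proof -
    have c': "c \<in> atlas S"
      using c sub by auto
    have linear_lim: "(\<lambda>k. A (zs k)) \<longlonglongrightarrow> A z" if "linear A" "zs \<longlonglongrightarrow> z"
      for A :: "real^2 \<Rightarrow> real^2" and zs z
      using isCont_tendsto_compose[OF linear_continuous_at that(2)] that(1)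
      by (simp add: linear_conv_bounded_linear)
    define ws where "ws k = identify S c (xs k) y (vs k)" for k
    have "ws \<longlonglongrightarrow> of_coords S c y (to_coords S c y u)"
      unfolding ws_def identify_def
      by (rule linear_lim[OF linear_coords(2)[OF c' c(2)] tconv_coords[OF t c' c(2)]])
    then have w: "tconv S (\<lambda>_. y) ws y u"
      using c' c by (intro tconvI[OF tendsto_const chart_at]) simp
    have un: "tconv S (\<lambda>_. y) (\<lambda>_. u) y u"
      by (simp add: tconv_def)
    have "(\<lambda>k. \<bar>metric S y (ws k) u\<bar> / (rnorm S y (ws k) * rnorm S y u))
        \<longlonglongrightarrow> \<bar>metric S y u u\<bar> / (rnorm S y u * rnorm S y u)"
      using u(2) by (intro tendsto_intros tconv_metric[OF w un] tconv_rnorm[OF w]) simp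
    then have "(\<lambda>k. \<bar>metric S y (ws k) u\<bar> / (rnorm S y (ws k) * rnorm S y u)) \<longlonglongrightarrow> 1"
      using u(2) metric_pos[OF u(2), of y] by (simp flip: power2_eq_square)
    \<comment> \<open>The bound is needed for every \<open>k\<close>, to stay where
      \<open>arccos\<close> is continuous; if \<open>ws k\<close> vanishes, the quotient is 0 by the
      convention for division.\<close>
    moreover have "\<bar>metric S y (ws k) u\<bar> / (rnorm S y (ws k) * rnorm S y u) \<in> {-1..1}" for k
    proof -
      have "\<bar>metric S y (ws k) u\<bar> / (rnorm S y (ws k) * rnorm S y u) \<le> 1"
        by (rule divide_le_eq_1[THEN iffD2]) (use Cauchy_Schwarz[of y "ws k" u] in \<open>auto simp: less_le\<close>)
      moreover have "0 \<le> \<bar>metric S y (ws k) u\<bar> / (rnorm S y (ws k) * rnorm S y u)"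
        by simp
      ultimately show ?thesis
        using order_trans[of "-1" 0] atLeastAtMost_iff by (metis neg_le_0_iff_le zero_le_one)
    qed
    ultimately have "(\<lambda>k. line_angle S y (ws k) u) \<longlonglongrightarrow> arccos 1"
      unfolding line_angle_def
      by (intro continuous_on_tendsto_compose[OF continuous_on_arccos']) auto
    then have "(\<lambda>k. line_angle S y (ws k) u) \<longlonglongrightarrow> 0"
      by simp
    then show ?thesis
      using order_tendstoD(2)[OF _ \<epsilon>] by (simp add: ws_def)
  qed
  \<comment> \<open>Finiteness of \<open>Q\<close> gives one threshold for all charts; those that do
    not contain \<open>y\<close> impose no condition.\<close>
  have "eventually (\<lambda>k. \<forall>c\<in>Q. y \<in> fst c \<longrightarrow> line_angle S y (identify S c (xs k) y (vs k)) u < \<epsilon>) sequentially"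
    using fin by (rule eventually_ball_finite) (use angle in \<open>auto intro: always_eventually\<close>)
  moreover have "eventually (\<lambda>k. xs k \<in> fst c0) sequentially"
    by (rule eventually_in_chart[OF tconv_lim[OF t] subsetD[OF sub c0(1)] c0(2)])
  moreover have "eventually (\<lambda>k. dist (xs k) y < \<epsilon>) sequentially"
    using tendstoD[OF tconv_lim[OF t] \<epsilon>] .
  ultimately show ?thesis
  proof eventually_elim
    case (elim k)
    then show ?case
      unfolding slope_less_def using y u c0 by blast
  qed
qed

text \<open>Eventual validity along all sequences converging to a vector is inherited by the vectors
  near it, although the tangent bundle carries no topology here.\<close>

lemma eventually_tconv_nested:
  assumes P: "\<And>xs vs. tconv S xs vs z u \<Longrightarrow> eventually (\<lambda>k. P (xs k) (vs k)) sequentially"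
    and t: "tconv S ys ws z u"
  shows "\<exists>j. \<forall>xs vs. tconv S xs vs (ys j) (ws j) \<longrightarrow> eventually (\<lambda>k. P (xs k) (vs k)) sequentially"
proof -
  define c where "c = chart_at S z"
  have c: "c \<in> atlas S" "z \<in> fst c"
    by (simp_all add: c_def)
  \<comment> \<open>A radius \<eta> in one fixed chart replaces a neighbourhood in the tangent
    bundle. If there were none, the radii \<open>1 / (k + 1)\<close> would produce a sequence
    converging to \<open>u\<close> along which \<open>P\<close> always fails.\<close>
  have "\<exists>\<eta>>0. \<forall>x v. x \<in> fst c \<and> dist x z < \<eta> \<and> dist (to_coords S c x v) (to_coords S c z u) < \<eta> \<longrightarrow> P x v"
  proof (rule ccontr)
    assume "\<not> ?thesis"
    then have "\<exists>x v. x \<in> fst c \<and> dist x z < inverse (real (Suc k)) \<and>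
        dist (to_coords S c x v) (to_coords S c z u) < inverse (real (Suc k)) \<and> \<not> P x v" for k
      by (metis inverse_positive_iff_positive of_nat_0_less_iff zero_less_Suc)
    then obtain xs vs where xv: "\<And>k. dist (xs k) z < inverse (real (Suc k))"
        "\<And>k. dist (to_coords S c (xs k) (vs k)) (to_coords S c z u) < inverse (real (Suc k))"
        "\<And>k. \<not> P (xs k) (vs k)"
      by metis
    have lim: "X \<longlonglongrightarrow> x" if "\<And>k. dist (X k) x < inverse (real (Suc k))" for X and x :: "'b::metric_space"
      by (rule metric_tendsto_imp_tendsto[OF LIMSEQ_inverse_real_of_nat])
        (use that in \<open>auto intro!: always_eventually less_imp_le\<close>)
    have "tconv S xs vs z u"
      by (rule tconvI[OF lim[OF xv(1)] c lim[OF xv(2)]])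
    then show False
      using P xv(3) by fastforce
  qed
  then obtain \<eta> where \<eta>: "\<eta> > 0" and P': "\<And>x v. x \<in> fst c \<Longrightarrow> dist x z < \<eta> \<Longrightarrow>
      dist (to_coords S c x v) (to_coords S c z u) < \<eta> \<Longrightarrow> P x v"
    by blast
  have ev: "eventually (\<lambda>k. xs k \<in> fst c \<and> dist (xs k) z < \<eta> \<and>
      dist (to_coords S c (xs k) (vs k)) (to_coords S c z u) < \<eta>) sequentially"
    if "tconv S xs vs y w" "y \<in> fst c" "dist y z < \<eta>" "dist (to_coords S c y w) (to_coords S c z u) < \<eta>"
    for xs vs y w
    using eventually_in_chart[OF tconv_lim[OF that(1)] c(1) that(2)]
      order_tendstoD(2)[OF tendsto_dist[OF tconv_lim[OF that(1)] tendsto_const] that(3)]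
      order_tendstoD(2)[OF tendsto_dist[OF tconv_coords[OF that(1) c(1) that(2)] tendsto_const] that(4)]
    by eventually_elim simp
  obtain j where j: "ys j \<in> fst c" "dist (ys j) z < \<eta>"
      "dist (to_coords S c (ys j) (ws j)) (to_coords S c z u) < \<eta>"
    using ev[OF t c(2)] \<eta> eventually_happens'[OF sequentially_bot] by fastforce
  have "eventually (\<lambda>k. P (xs k) (vs k)) sequentially" if "tconv S xs vs (ys j) (ws j)" for xs vs
    using ev[OF that j] by eventually_elim (use P' in blast)
  then show ?thesis
    by blast
qed

lemma unit_vectors_compact2:
  fixes xs :: "nat \<Rightarrow> 'm"
  assumes comp: "compact (UNIV :: 'm set)"
    and vs: "\<And>k. rnorm S (xs k) (vs k) = 1" and ws: "\<And>k. rnorm S (xs k) (ws k) = 1"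
  obtains r y v w where "strict_mono r" "tconv S (\<lambda>k. xs (r k)) (\<lambda>k. vs (r k)) y v"
    "tconv S (\<lambda>k. xs (r k)) (\<lambda>k. ws (r k)) y w" "rnorm S y v = 1" "rnorm S y w = 1"
proof -
  obtain r y v where r: "strict_mono r" and v: "tconv S (\<lambda>k. xs (r k)) (\<lambda>k. vs (r k)) y v" "rnorm S y v = 1"
    using unit_vectors_compact[OF comp, of xs vs] vs by blast
  obtain r' y' w where r': "strict_mono r'"
      and w: "tconv S (\<lambda>k. xs (r (r' k))) (\<lambda>k. ws (r (r' k))) y' w" "rnorm S y' w = 1"
    using unit_vectors_compact[OF comp, of "\<lambda>k. xs (r k)" "\<lambda>k. ws (r k)"] ws by blast
  have v': "tconv S (\<lambda>k. xs (r (r' k))) (\<lambda>k. vs (r (r' k))) y v"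
    using tconv_subseq[OF v(1) r'] .
  then have "y' = y"
    using LIMSEQ_unique[OF tconv_lim tconv_lim] w(1) by blast
  moreover have "strict_mono (\<lambda>k. r (r' k))"
    using strict_mono_o[OF r r'] by (simp add: o_def)
  ultimately show ?thesis
    using that[of "\<lambda>k. r (r' k)"] v' v w by blast
qed

text \<open>Lying on the line amounts to a vanishing determinant against the continuous spanning
  field \<open>s\<close>, which is a closed condition in coordinates.\<close>

lemma line_subbundle_tconv:
  assumes L: "line_subbundle S K L" and xs: "\<And>k. xs k \<in> K" and vs: "\<And>k. vs k \<in> L (xs k)"
    and t: "tconv S xs vs y w" and y: "y \<in> K"
  shows "w \<in> L y"
proof -
  obtain V s where V: "open V" "y \<in> V" and s: "continuous_on (K \<inter> V) s"
    and span: "\<And>x. x \<in> K \<inter> V \<Longrightarrow> s x \<noteq> 0 \<and> to_coords S (chart_at S y) x ` L x = span {s x}"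
    using L y unfolding line_subbundle_def by metis
  let ?z = "\<lambda>k. to_coords S (chart_at S y) (xs k) (vs k)"
  have ev: "eventually (\<lambda>k. xs k \<in> K \<inter> V) sequentially"
    using topological_tendstoD[OF tconv_lim[OF t] V] xs by simp
  have lim_s: "(\<lambda>k. s (xs k)) \<longlonglongrightarrow> s y"
    using continuous_on_tendsto_compose[OF s tconv_lim[OF t] _ ev] y V by simp
  have lim_z: "?z \<longlonglongrightarrow> w"
    using tconv_coords[OF t chart_at] by simp
  have "(\<lambda>k. cross (?z k) (s (xs k))) \<longlonglongrightarrow> cross w (s y)"
    unfolding cross_def by (intro tendsto_intros tendsto_vec_nth lim_s lim_z)
  moreover have "eventually (\<lambda>k. cross (?z k) (s (xs k)) = 0) sequentially"
    using ev
  proof eventually_elim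
    case (elim k)
    then have "?z k \<in> span {s (xs k)}"
      using span[OF elim] vs[of k] by blast
    then show ?case
      by (auto simp: span_singleton cross_def)
  qed
  ultimately have "cross w (s y) = 0"
    using LIMSEQ_unique[OF _ tendsto_eventually] by fastforce
  moreover have sy: "s y \<noteq> 0" "L y = span {s y}"
    using span[of y] y V by auto
  ultimately show ?thesis
    using cross_eq_0[of w "s y"] by (auto simp: span_singleton)
qed

lemma line_subbundle_unit:
  assumes "line_subbundle S K L" "x \<in> K"
  obtains u where "u \<in> L x" "rnorm S x u = 1" "L x = range (\<lambda>t. t *\<^sub>R u)"
proof -
  have "subspace (L x)" "dim (L x) = 1"
    using assms by (auto simp: line_subbundle_def)
  then obtain X where "X \<subseteq> L x" "independent X" "L x \<subseteq> span X" "card X = 1"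
    using basis_exists[of "L x"] by metis
  then obtain b where "b \<in> L x" "independent {b}" "L x \<subseteq> span {b}"
    by (auto simp: card_1_singleton_iff)
  then have b: "L x = span {b}" "b \<noteq> 0"
    using \<open>subspace (L x)\<close> span_minimal[of "{b}" "L x"] dependent_zero by auto
  define u where "u = (1 / rnorm S x b) *\<^sub>R b"
  have u: "rnorm S x u = 1" "b = rnorm S x b *\<^sub>R u"
    using b(2) by (simp_all add: u_def)
  have "L x = range (\<lambda>t. t *\<^sub>R u)"
  proof -
    have "t *\<^sub>R b = (t * rnorm S x b) *\<^sub>R u" "t *\<^sub>R u = (t / rnorm S x b) *\<^sub>R b" for t
      using u(2) by (simp_all add: u_def)
    then show ?thesis
      unfolding b(1) span_singleton by (metis (no_types, lifting) image_cong UNIV_I image_subset_iff rangeI subset_antisym)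
  qed
  moreover have "u \<in> L x"
    unfolding b(1) u_def by (simp add: span_base span_scale)
  ultimately show ?thesis
    using that u(1) by blast
qed

end

section \<open>Orbits that avoid one of the bundles\<close>

text \<open>Phrased for pairs of vectors, so that it is symmetric under passing to the inverse and
  exchanging the bundles.\<close>

definition dominated ::
    "'m riem_surface \<Rightarrow> ('m \<Rightarrow> 'm) \<Rightarrow> 'm set \<Rightarrow> ('m \<Rightarrow> (real^2) set) \<Rightarrow> ('m \<Rightarrow> (real^2) set) \<Rightarrow> bool" where
  "dominated S h K E F \<longleftrightarrow> (\<exists>C>0. \<exists>r>0. r < 1 \<and>
     (\<forall>x\<in>K. \<forall>v\<in>E x. \<forall>w\<in>F x. \<forall>n.
        rnorm S ((h ^^ n) x) (differential S (h ^^ n) x v) * rnorm S x w \<le>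
        C * r ^ n * (rnorm S ((h ^^ n) x) (differential S (h ^^ n) x w) * rnorm S x v)))"

lemma cross_decompose:
  assumes "cross v w \<noteq> 0"
  shows "\<exists>a b. z = a *\<^sub>R v + b *\<^sub>R w"
proof (intro exI)
  show "z = (cross z w / cross v w) *\<^sub>R v + (cross v z / cross v w) *\<^sub>R w"
    using assms by (simp add: vec_eq_iff forall_2 field_simps) (simp add: cross_def algebra_simps)
qed

text \<open>The unit vectors of a line are \<open>u\<close> and its negative, whose images have
  equal length; the supremum is taken over a single value.\<close>

lemma (in surface) restr_norm_line:
  assumes h: "C1_map S h" and u: "u \<in> L" "rnorm S x u = 1" and L: "L = range (\<lambda>t. t *\<^sub>R u)"
  shows "restr_norm S h x L = rnorm S (h x) (differential S h x u)"
proof -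
  have "rnorm S (h x) (differential S h x v) = rnorm S (h x) (differential S h x u)"
    if "v \<in> L" "rnorm S x v = 1" for v
    using that u(2) linear_scale[OF linear_differential[OF h]] by (auto simp: L)
  then have "{rnorm S (h x) (differential S h x v) |v. v \<in> L \<and> rnorm S x v = 1} =
      {rnorm S (h x) (differential S h x u)}"
    using u by blast
  then show ?thesis
    by (simp add: restr_norm_def)
qed

section \<open>Geometry and dynamics of a dominated splitting\<close>

locale splitting = surface S for S :: "'m::metric_space riem_surface" +
  fixes h :: "'m \<Rightarrow> 'm" and K :: "'m set" and E F :: "'m \<Rightarrow> (real^2) set"
  assumes comp: "compact (UNIV :: 'm set)" and diffeo: "C1_diffeo S h"
    and K_invariant: "h ` K = K" and closed_K: "closed K"
    and line_E: "line_subbundle S K E" and line_F: "line_subbundle S K F"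
    and E_Int_F: "x \<in> K \<Longrightarrow> E x \<inter> F x = {0}"
    and E_invariant: "x \<in> K \<Longrightarrow> differential S h x ` E x = E (h x)"
    and F_invariant: "x \<in> K \<Longrightarrow> differential S h x ` F x = F (h x)"
    and dominated: "dominated S h K E F"
begin

lemmas map = C1_diffeo_map[OF diffeo] and bij = C1_diffeo_bij[OF diffeo]
  and diffeo_funpow = C1_diffeo_funpow[OF diffeo]

lemma K_funpow: "x \<in> K \<Longrightarrow> (h ^^ n) x \<in> K"
  using K_invariant by (induction n) auto

lemma invariant_funpow:
  assumes inv: "\<And>x. x \<in> K \<Longrightarrow> differential S h x ` L x = L (h x)" and x: "x \<in> K" and v: "v \<in> L x"
  shows "differential S (h ^^ n) x v \<in> L ((h ^^ n) x)"
proof (induction n)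
  case 0
  then show ?case
    using v by (simp flip: id_def)
next
  case (Suc n)
  have "differential S (h ^^ Suc n) x v = differential S h ((h ^^ n) x) (differential S (h ^^ n) x v)"
    using differential_comp[OF map C1_map_funpow[OF map]] by simp
  then show ?case
    using inv[OF K_funpow[OF x]] Suc by (auto simp: o_def)
qed

text \<open>Domination of \<open>h\<close> at the point \<open>(inv h ^^ n) x\<close>, applied to
  vectors pulled back from \<open>x\<close>, is domination of \<open>inv h\<close> at
  \<open>x\<close> with the bundles exchanged and the same constants \<open>C\<close> and
  \<open>r\<close>.\<close>

lemma splitting_inv: "splitting S (inv h) K F E"
proof -
  have K_inv: "inv h ` K = K"
    using K_invariant bij by (metis bij_is_inj image_inv_f_f)
  have inv: "differential S (inv h) x ` L x = L (inv h x)"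
    if "\<And>x. x \<in> K \<Longrightarrow> differential S h x ` L x = L (h x)" "x \<in> K" for L x
  proof -
    have y: "inv h x \<in> K" "h (inv h x) = x"
      using K_inv that(2) bij by auto
    then have "L x = differential S h (inv h x) ` L (inv h x)"
      using that(1) by metis
    then show ?thesis
      using differential_inv(1)[OF diffeo, of "inv h x"] y(2) by (simp add: image_image)
  qed
  have "dominated S (inv h) K F E"
  proof -
    obtain C r where C: "C > 0" "r > 0" "r < 1" and dom: "\<And>x v w n. x \<in> K \<Longrightarrow> v \<in> E x \<Longrightarrow> w \<in> F x \<Longrightarrow>
        rnorm S ((h ^^ n) x) (differential S (h ^^ n) x v) * rnorm S x w \<le>
        C * r ^ n * (rnorm S ((h ^^ n) x) (differential S (h ^^ n) x w) * rnorm S x v)"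
      using dominated unfolding dominated_def by blast
    have "rnorm S ((inv h ^^ n) x) (differential S (inv h ^^ n) x w) * rnorm S x v \<le>
        C * r ^ n * (rnorm S ((inv h ^^ n) x) (differential S (inv h ^^ n) x v) * rnorm S x w)"
      if x: "x \<in> K" and w: "w \<in> F x" and v: "v \<in> E x" for x v w n
    proof -
      define y where "y = (inv h ^^ n) x"
      have y: "y \<in> K"
        unfolding y_def using K_inv x by (induction n) auto
      have x_eq: "(h ^^ n) y = x"
        by (simp add: y_def funpow_inv_cancel(2)[OF bij])
      have pull: "differential S (inv h ^^ n) x u \<in> L y"
        if "\<And>x. x \<in> K \<Longrightarrow> differential S h x ` L x = L (h x)" "u \<in> L x" for L u
      proof -
        have "differential S (inv h ^^ m) x u \<in> L ((inv h ^^ m) x) \<and> (inv h ^^ m) x \<in> K" for m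
        proof (induction m)
          case 0
          then show ?case
            using x that by (simp flip: id_def)
        next
          case (Suc m)
          have "differential S (inv h ^^ Suc m) x u =
              differential S (inv h) ((inv h ^^ m) x) (differential S (inv h ^^ m) x u)"
            using differential_comp C1_map_funpow C1_diffeo_map[OF C1_diffeo_inv[OF diffeo]] by simp
          then show ?case
            using inv[OF that(1)] Suc K_inv by (auto simp: o_def)
        qed
        then show ?thesis
          by (simp add: y_def)
      qed
      have push: "differential S (h ^^ n) y (differential S (inv h ^^ n) x u) = u" for u
        using differential_inv(2)[OF diffeo_funpow, of n x u] by (simp add: y_def inv_fn[OF bij])
      show ?thesis
        using dom[OF y pull[OF E_invariant v] pull[OF F_invariant w], of n]
        by (simp add: push x_eq mult.commute flip: y_def)
    qed
    then show ?thesis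
      unfolding dominated_def using C by blast
  qed
  then show ?thesis
    by (intro splitting.intro splitting_axioms.intro)
      (use surface_axioms comp C1_diffeo_inv[OF diffeo] K_inv closed_K line_E line_F E_Int_F inv
        E_invariant F_invariant in auto)
qed

text \<open>The angle between the bundles is uniformly positive: in the limit of a sequence of
  angles tending to 0, closedness of the subbundles would give a common unit vector of
  \<open>E\<close> and \<open>F\<close>.\<close>

lemma area_lower_bound:
  "\<exists>a>0. \<forall>x\<in>K. \<forall>v\<in>E x. \<forall>w\<in>F x. rnorm S x v = 1 \<longrightarrow> rnorm S x w = 1 \<longrightarrow> a \<le> area S x v w"
proof (rule ccontr)
  assume "\<not> ?thesis"
  then have "\<exists>x v w. x \<in> K \<and> v \<in> E x \<and> w \<in> F x \<and> rnorm S x v = 1 \<and> rnorm S x w = 1 \<and>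
      area S x v w < inverse (real (Suc k))" for k
    by (meson inverse_positive_iff_positive not_le of_nat_0_less_iff zero_less_Suc)
  then obtain xs vs ws where xs: "\<And>k. xs k \<in> K" and vs: "\<And>k. vs k \<in> E (xs k)" "\<And>k. rnorm S (xs k) (vs k) = 1"
      and ws: "\<And>k. ws k \<in> F (xs k)" "\<And>k. rnorm S (xs k) (ws k) = 1"
      and area: "\<And>k. area S (xs k) (vs k) (ws k) < inverse (real (Suc k))"
    by metis
  obtain r y v w where r: "strict_mono r" and v: "tconv S (\<lambda>k. xs (r k)) (\<lambda>k. vs (r k)) y v"
      and w: "tconv S (\<lambda>k. xs (r k)) (\<lambda>k. ws (r k)) y w" and 1: "rnorm S y v = 1" "rnorm S y w = 1"
    by (rule unit_vectors_compact2[OF comp vs(2) ws(2)])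
  have y: "y \<in> K"
    by (rule closed_sequentially[OF closed_K _ tconv_lim[OF v]]) (rule xs)
  have "(\<lambda>k. area S (xs k) (vs k) (ws k)) \<longlonglongrightarrow> 0"
    by (rule tendsto_sandwich[OF always_eventually always_eventually tendsto_const LIMSEQ_inverse_real_of_nat])
      (use area in \<open>auto intro: less_imp_le\<close>)
  then have "area S y v w = 0"
    using LIMSEQ_unique[OF tconv_area[OF v w]] LIMSEQ_subseq_LIMSEQ[OF _ r] by (fastforce simp: o_def)
  then obtain t where "v = t *\<^sub>R w"
    using area_eq_0 unit_nonzero[OF 1(2)] by blast
  moreover have "v \<in> E y" "w \<in> F y"
    by (rule line_subbundle_tconv[OF line_E xs vs(1) v y],
        rule line_subbundle_tconv[OF line_F xs ws(1) w y])
  moreover have "subspace (F y)"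
    using line_F y by (auto simp: line_subbundle_def)
  ultimately have "v \<in> E y \<inter> F y"
    by (simp add: subspace_scale)
  then show False
    using E_Int_F[OF y] unit_nonzero[OF 1(1)] by auto
qed

text \<open>With unit vectors \<open>v\<close> in \<open>E\<close> and \<open>w\<close> in
  \<open>F\<close>, the area spanned by their images is \<open>jac\<close> times an area of at least
  \<open>a\<close>, and at most the product of the lengths of the images. Domination bounds the
  image of \<open>v\<close> by \<open>C * r ^ n\<close> times that of \<open>w\<close>, which leaves
  \<open>dir_deriv\<close> at most \<open>C * r ^ n / a\<close>.\<close>

lemma dir_deriv_F_contracts:
  "\<exists>L>0. \<forall>x\<in>K. \<forall>w\<in>F x. rnorm S x w = 1 \<longrightarrow> dir_deriv S (h ^^ L) x w < 1/2"
proof -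
  obtain C r where C: "C > 0" "r > 0" "r < 1" and dom: "\<And>x v w n. x \<in> K \<Longrightarrow> v \<in> E x \<Longrightarrow> w \<in> F x \<Longrightarrow>
      rnorm S ((h ^^ n) x) (differential S (h ^^ n) x v) * rnorm S x w \<le>
      C * r ^ n * (rnorm S ((h ^^ n) x) (differential S (h ^^ n) x w) * rnorm S x v)"
    using dominated unfolding dominated_def by blast
  obtain a where a: "a > 0" and area: "\<And>x v w. x \<in> K \<Longrightarrow> v \<in> E x \<Longrightarrow> w \<in> F x \<Longrightarrow>
      rnorm S x v = 1 \<Longrightarrow> rnorm S x w = 1 \<Longrightarrow> a \<le> area S x v w"
    using area_lower_bound by blast
  have bound: "dir_deriv S (h ^^ n) x w \<le> C * r ^ n / a"
    if x: "x \<in> K" and w: "w \<in> F x" "rnorm S x w = 1" for x w n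
  proof -
    obtain v where v: "v \<in> E x" "rnorm S x v = 1"
      using line_subbundle_unit[OF line_E x] by blast
    define v' w' where "v' = rnorm S ((h ^^ n) x) (differential S (h ^^ n) x v)"
      and "w' = rnorm S ((h ^^ n) x) (differential S (h ^^ n) x w)"
    have w': "w' > 0"
      using unit_nonzero[OF w(2)] by (simp add: w'_def diffeo_funpow)
    have "jac S (h ^^ n) x * a \<le> jac S (h ^^ n) x * area S x v w"
      by (intro mult_left_mono area x v w) simp
    also have "\<dots> \<le> v' * w'"
      unfolding v'_def w'_def area_differential[OF C1_map_funpow[OF map], symmetric] by (rule area_le)
    also have "\<dots> \<le> C * r ^ n * w' * w'"
      using dom[OF x v(1) w(1), of n] v(2) w(2) w' by (intro mult_right_mono) (simp_all add: v'_def w'_def)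
    finally have "jac S (h ^^ n) x * a \<le> C * r ^ n * w'\<^sup>2"
      by (simp add: power2_eq_square mult.assoc)
    then show ?thesis
      using a w' by (simp add: dir_deriv_def field_simps flip: w'_def)
  qed
  have "(\<lambda>n. C * r ^ n / a) \<longlonglongrightarrow> C * 0 / a"
    using C by (intro tendsto_intros LIMSEQ_power_zero) (use a in auto)
  then have "eventually (\<lambda>n. C * r ^ n / a < 1/2) sequentially"
    by (rule order_tendstoD(2)) simp
  then have "eventually (\<lambda>n. C * r ^ n / a < 1/2 \<and> n > 0) sequentially"
    using eventually_gt_at_top[of 0] by eventually_elim simp
  then obtain L where L: "C * r ^ L / a < 1/2" "L > 0"
    using eventually_happens'[OF sequentially_bot] by blast
  then show ?thesis
    using bound order_le_less_trans by (intro exI[of _ L]) blast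
qed

text \<open>A direction outside \<open>E\<close> has a nonzero component along \<open>F\<close>, and
  under iteration its component along \<open>E\<close> becomes negligible in comparison. The angle
  is measured by \<open>area\<close> against the image of a unit vector of \<open>F\<close>, and
  decays like \<open>r ^ n\<close>.\<close>

lemma dir_accumulates_at_F:
  assumes y: "y \<in> K" and w: "rnorm S y w = 1" "w \<notin> E y"
  obtains s z u where "strict_mono s" "z \<in> K" "u \<in> F z" "rnorm S z u = 1"
    "tconv S (\<lambda>j. (h ^^ s j) y) (\<lambda>j. dir S (h ^^ s j) y w) z u"
proof -
  obtain C r where C: "C > 0" "r > 0" "r < 1" and dom: "\<And>x v w n. x \<in> K \<Longrightarrow> v \<in> E x \<Longrightarrow> w \<in> F x \<Longrightarrow>
      rnorm S ((h ^^ n) x) (differential S (h ^^ n) x v) * rnorm S x w \<le>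
      C * r ^ n * (rnorm S ((h ^^ n) x) (differential S (h ^^ n) x w) * rnorm S x v)"
    using dominated unfolding dominated_def by blast
  obtain e where e: "e \<in> E y" "rnorm S y e = 1"
    using line_subbundle_unit[OF line_E y] by blast
  obtain p where p: "p \<in> F y" "rnorm S y p = 1"
    using line_subbundle_unit[OF line_F y] by blast
  have sub: "subspace (E x)" "subspace (F x)" if "x \<in> K" for x
    using line_E line_F that by (auto simp: line_subbundle_def)
  have "cross e p \<noteq> 0"
  proof
    assume "cross e p = 0"
    then obtain t where "e = t *\<^sub>R p"
      using cross_eq_0 unit_nonzero[OF p(2)] by blast
    then have "e \<in> E y \<inter> F y"
      using e p sub[OF y] by (simp add: subspace_scale)
    then show False
      using E_Int_F[OF y] unit_nonzero[OF e(2)] by auto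
  qed
  then obtain a b where ab: "w = a *\<^sub>R e + b *\<^sub>R p"
    using cross_decompose by blast
  have b: "b \<noteq> 0"
    using w(2) e(1) sub[OF y] ab by (auto simp: subspace_scale)
  define w' p' where "w' n = dir S (h ^^ n) y w" and "p' n = dir S (h ^^ n) y p" for n
  have w': "rnorm S ((h ^^ n) y) (w' n) = 1" and p': "rnorm S ((h ^^ n) y) (p' n) = 1" for n
    using rnorm_dir[OF diffeo_funpow] unit_nonzero w(1) p(2) by (auto simp: w'_def p'_def)
  have p'_F: "p' n \<in> F ((h ^^ n) y)" for n
    unfolding p'_def dir_def
    by (intro subspace_scale sub K_funpow y invariant_funpow F_invariant p)
  have area_bound: "area S ((h ^^ n) y) (w' n) (p' n) \<le> 2 * \<bar>a\<bar> * C / \<bar>b\<bar> * r ^ n"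
    if n: "\<bar>a\<bar> * C * r ^ n \<le> \<bar>b\<bar> / 2" for n
  proof -
    let ?x = "(h ^^ n) y" and ?D = "differential S (h ^^ n) y"
    note lin = linear_differential[OF C1_map_funpow[OF map], of n y]
    have Dw: "?D w = a *\<^sub>R ?D e + b *\<^sub>R ?D p"
      by (simp add: ab linear_add[OF lin] linear_scale[OF lin])
    have pos: "rnorm S ?x (?D p) > 0" "rnorm S ?x (?D w) > 0"
      using unit_nonzero p(2) w(1) by (auto simp: diffeo_funpow)
    have De: "rnorm S ?x (?D e) \<le> C * r ^ n * rnorm S ?x (?D p)"
      using dom[OF y e(1) p(1), of n] e(2) p(2) by simp
    \<comment> \<open>By the choice of \<open>n\<close> the image of \<open>a *\<^sub>R e\<close> is
      at most half as long as that of \<open>b *\<^sub>R p\<close>, so the image of \<open>w\<close>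
      keeps at least half the length of the latter.\<close>
    have "\<bar>b\<bar> * rnorm S ?x (?D p) = rnorm S ?x (?D w + (- a) *\<^sub>R ?D e)"
      by (simp add: Dw)
    also have "\<dots> \<le> rnorm S ?x (?D w) + \<bar>a\<bar> * rnorm S ?x (?D e)"
      using rnorm_triangle[of ?x "?D w" "(- a) *\<^sub>R ?D e"] by (simp only: rnorm_scaleR abs_minus_cancel)
    also have "\<bar>a\<bar> * rnorm S ?x (?D e) \<le> \<bar>a\<bar> * (C * r ^ n * rnorm S ?x (?D p))"
      using De by (rule mult_left_mono) simp
    also have "\<dots> \<le> \<bar>b\<bar> / 2 * rnorm S ?x (?D p)"
      using mult_right_mono[OF n, of "rnorm S ?x (?D p)"] by (simp add: mult.assoc)
    finally have w_ge: "\<bar>b\<bar> / 2 * rnorm S ?x (?D p) \<le> rnorm S ?x (?D w)"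
      by simp
    have "area S ?x (w' n) (p' n) = area S ?x (?D w) (?D p) / (rnorm S ?x (?D w) * rnorm S ?x (?D p))"
      by (simp add: w'_def p'_def dir_def area_scaleR divide_inverse)
    also have "area S ?x (?D w) (?D p) = \<bar>a\<bar> * area S ?x (?D e) (?D p)"
      unfolding Dw by (rule area_add_scaleR)
    also have "\<dots> \<le> \<bar>a\<bar> * (rnorm S ?x (?D e) * rnorm S ?x (?D p))"
      by (intro mult_left_mono area_le) simp
    also have "\<dots> \<le> \<bar>a\<bar> * (C * r ^ n * rnorm S ?x (?D p) * rnorm S ?x (?D p))"
      using De by (intro mult_left_mono mult_right_mono) auto
    also have "\<bar>a\<bar> * (C * r ^ n * rnorm S ?x (?D p) * rnorm S ?x (?D p)) /
        (rnorm S ?x (?D w) * rnorm S ?x (?D p)) = \<bar>a\<bar> * C * r ^ n * rnorm S ?x (?D p) / rnorm S ?x (?D w)"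
      using pos by simp
    also have "\<dots> \<le> \<bar>a\<bar> * C * r ^ n * rnorm S ?x (?D p) / (\<bar>b\<bar> / 2 * rnorm S ?x (?D p))"
      using w_ge pos b C by (intro divide_left_mono) auto
    also have "\<dots> = 2 * \<bar>a\<bar> * C / \<bar>b\<bar> * r ^ n"
      using pos b by simp
    finally show ?thesis
      using pos by (simp add: divide_right_mono)
  qed
  have r0: "(\<lambda>n. c * r ^ n) \<longlonglongrightarrow> 0" for c
    using C by (intro tendsto_mult_right_zero LIMSEQ_power_zero) auto
  have "eventually (\<lambda>n. \<bar>a\<bar> * C * r ^ n < \<bar>b\<bar> / 2) sequentially"
    using order_tendstoD(2)[OF r0[of "\<bar>a\<bar> * C"], of "\<bar>b\<bar> / 2"] b by simp
  then have "eventually (\<lambda>n. area S ((h ^^ n) y) (w' n) (p' n) \<le> 2 * \<bar>a\<bar> * C / \<bar>b\<bar> * r ^ n) sequentially"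
    by eventually_elim (rule area_bound, simp)
  then have lim: "(\<lambda>n. area S ((h ^^ n) y) (w' n) (p' n)) \<longlonglongrightarrow> 0"
    by (rule tendsto_sandwich[OF always_eventually _ tendsto_const r0, rotated]) simp
  \<comment> \<open>Both sequences of directions converge along the same times, so that the limit
    \<open>u\<close> can be compared with \<open>q\<close>, which lies in \<open>F z\<close>;
    vanishing area makes them parallel.\<close>
  obtain s z u q where s: "strict_mono s" and u: "tconv S (\<lambda>k. (h ^^ s k) y) (\<lambda>k. w' (s k)) z u"
      and q: "tconv S (\<lambda>k. (h ^^ s k) y) (\<lambda>k. p' (s k)) z q" and 1: "rnorm S z u = 1" "rnorm S z q = 1"
    by (rule unit_vectors_compact2[OF comp w' p'])
  have z: "z \<in> K"
    by (rule closed_sequentially[OF closed_K _ tconv_lim[OF u]]) (rule K_funpow[OF y])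
  have "q \<in> F z"
    by (rule line_subbundle_tconv[OF line_F K_funpow[OF y] p'_F q z])
  moreover have "area S z u q = 0"
    using LIMSEQ_unique[OF tconv_area[OF u q]] LIMSEQ_subseq_LIMSEQ[OF lim s] by (simp add: o_def)
  then obtain t where "u = t *\<^sub>R q"
    using area_eq_0 unit_nonzero[OF 1(2)] by blast
  ultimately have "u \<in> F z"
    using sub[OF z] by (simp add: subspace_scale)
  then show ?thesis
    using that s z 1(1) u by (simp add: w'_def)
qed

lemma dir_funpow_add:
  assumes "rnorm S x v = 1"
  shows "dir S (h ^^ (m + n)) x v = dir S (h ^^ m) ((h ^^ n) x) (dir S (h ^^ n) x v)"
    and "dir_deriv S (h ^^ (m + n)) x v =
      dir_deriv S (h ^^ m) ((h ^^ n) x) (dir S (h ^^ n) x v) * dir_deriv S (h ^^ n) x v"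
  unfolding funpow_add
  using dir_comp[OF diffeo_funpow diffeo_funpow] dir_deriv_comp[OF diffeo_funpow diffeo_funpow]
    unit_nonzero[OF assms] by auto

lemma dir_funpow_diff:
  assumes v: "rnorm S x v = 1" and j: "j \<le> m"
  shows "dir S (inv h ^^ j) ((h ^^ m) x) (dir S (h ^^ m) x v) = dir S (h ^^ (m - j)) x v"
proof -
  have "inv h ^^ j \<circ> h ^^ m = h ^^ (m - j)"
    using funpow_inv_diff[OF bij j] by (simp add: fun_eq_iff)
  then show ?thesis
    using dir_comp[OF C1_diffeo_funpow[OF C1_diffeo_inv[OF diffeo]] diffeo_funpow unit_nonzero[OF v], of j m]
    by simp
qed

text \<open>\<open>K\<close> is the maximal invariant subset of \<open>B\<close>, and
  \<open>P\<close> stands for being close to \<open>E\<close>. All that is retained of closeness is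
  that \<open>P\<close> holds eventually along sequences converging to a unit vector of
  \<open>E\<close> over \<open>K\<close>.\<close>

context
  fixes B :: "'m set" and P :: "'m \<Rightarrow> real^2 \<Rightarrow> bool"
  assumes closed_B: "closed B"
    and K_eq: "K = {y. \<forall>j. (h ^^ j) y \<in> B \<and> (inv h ^^ j) y \<in> B}"
    and P: "\<And>xs vs z u. tconv S xs vs z u \<Longrightarrow> z \<in> K \<Longrightarrow> u \<in> E z \<Longrightarrow> rnorm S z u = 1 \<Longrightarrow>
      eventually (\<lambda>k. P (xs k) (vs k)) sequentially"
begin

text \<open>Otherwise the backward orbit of the limit would accumulate at \<open>E\<close>, where \<open>P\<close> holds.\<close>

lemma limit_of_orbits_in_F:
  assumes t: "tconv S xs vs y w" and w: "rnorm S y w = 1"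
    and orbit: "\<And>k j. j \<le> k \<Longrightarrow> (h ^^ j) (xs k) \<in> B \<and> (inv h ^^ j) (xs k) \<in> B \<and>
      \<not> P ((inv h ^^ j) (xs k)) (dir S (inv h ^^ j) (xs k) (vs k))"
  shows "y \<in> K" "w \<in> F y"
proof -
  interpret inv: splitting S "inv h" K F E
    by (rule splitting_inv)
  have "(h ^^ j) y \<in> B \<and> (inv h ^^ j) y \<in> B" for j
  proof
    have ev: "eventually (\<lambda>k. j \<le> k) sequentially"
      by (rule eventually_ge_at_top)
    show "(h ^^ j) y \<in> B"
      by (rule Lim_in_closed_set[OF closed_B _ sequentially_bot
            C1_map_tendsto[OF C1_map_funpow[OF map] tconv_lim[OF t]]])
        (use ev in eventually_elim, simp add: orbit)
    show "(inv h ^^ j) y \<in> B"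
      by (rule Lim_in_closed_set[OF closed_B _ sequentially_bot
            C1_map_tendsto[OF C1_map_funpow[OF inv.map] tconv_lim[OF t]]])
        (use ev in eventually_elim, simp add: orbit)
  qed
  then show y: "y \<in> K"
    by (simp add: K_eq)
  show "w \<in> F y"
  proof (rule ccontr)
    assume "w \<notin> F y"
    \<comment> \<open>The bundles are exchanged in \<open>inv\<close>, so what is obtained is
      accumulation of the backward directions at \<open>E\<close>.\<close>
    then obtain s z u where z: "z \<in> K" "u \<in> E z" "rnorm S z u = 1"
        and u: "tconv S (\<lambda>j. (inv h ^^ s j) y) (\<lambda>j. dir S (inv h ^^ s j) y w) z u"
      using inv.dir_accumulates_at_F[OF y w] by metis
    \<comment> \<open>The time \<open>s j\<close> is fixed first, with the direction of the limit
      orbit already close to \<open>E\<close>; only afterwards does \<open>k\<close> grow, at this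
      fixed time.\<close>
    obtain j where j: "\<And>xs vs. tconv S xs vs ((inv h ^^ s j) y) (dir S (inv h ^^ s j) y w) \<Longrightarrow>
        eventually (\<lambda>k. P (xs k) (vs k)) sequentially"
      using eventually_tconv_nested[of z u P, OF P[OF _ z] u] by blast
    have "eventually (\<lambda>k. P ((inv h ^^ s j) (xs k)) (dir S (inv h ^^ s j) (xs k) (vs k))) sequentially"
      by (rule j[OF tconv_dir[OF inv.diffeo_funpow t unit_nonzero[OF w]]])
    moreover have "eventually (\<lambda>k. s j \<le> k) sequentially"
      by (rule eventually_ge_at_top)
    ultimately have "eventually (\<lambda>k. False) sequentially"
      by eventually_elim (use orbit in blast)
    then show False
      by simp
  qed
qed

lemma critical_orbit_meets_E:
  "\<exists>N>0. \<forall>x v n. rnorm S x v = 1 \<longrightarrow> (\<forall>j. dir_deriv S (h ^^ j) x v \<ge> 1) \<longrightarrow> N < n \<longrightarrow>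
     (\<forall>j. 0 < j \<and> j \<le> n \<longrightarrow> (h ^^ j) x \<in> B) \<longrightarrow>
     (\<exists>m. 0 < m \<and> m \<le> n \<and> P ((h ^^ m) x) (dir S (h ^^ m) x v))"
proof -
  obtain L where L: "L > 0" and contr: "\<And>x w. x \<in> K \<Longrightarrow> w \<in> F x \<Longrightarrow> rnorm S x w = 1 \<Longrightarrow>
      dir_deriv S (h ^^ L) x w < 1/2"
    using dir_deriv_F_contracts by blast
  define bad where "bad x v n \<longleftrightarrow> rnorm S x v = 1 \<and> (\<forall>j. 0 < j \<and> j \<le> n \<longrightarrow> (h ^^ j) x \<in> B \<and>
      \<not> P ((h ^^ j) x) (dir S (h ^^ j) x v))" for x v and n :: nat
  have unit: "rnorm S ((h ^^ n) x) (dir S (h ^^ n) x v) = 1" if "rnorm S x v = 1" for x v n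
    using rnorm_dir[OF diffeo_funpow unit_nonzero[OF that]] .
  \<comment> \<open>If no margin worked, there would be bad segments with times \<open>m k\<close>
    more than \<open>k\<close> away from both ends. Recentred at \<open>m k\<close> they have longer
    and longer pasts and futures, and their limit is a direction in \<open>F\<close>.\<close>
  have "\<exists>M. \<forall>x v n m. bad x v n \<longrightarrow> M \<le> m \<longrightarrow> m + M \<le> n \<longrightarrow>
      dir_deriv S (h ^^ L) ((h ^^ m) x) (dir S (h ^^ m) x v) < 1/2"
  proof (rule ccontr)
    assume "\<not> ?thesis"
    then have "\<exists>x v n m. bad x v n \<and> Suc k \<le> m \<and> m + Suc k \<le> n \<and>
        \<not> dir_deriv S (h ^^ L) ((h ^^ m) x) (dir S (h ^^ m) x v) < 1/2" for k
      by meson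
    then obtain x v n m where bad: "\<And>k. bad (x k) (v k) (n k)"
        and m: "\<And>k. Suc k \<le> m k" "\<And>k. m k + Suc k \<le> n k"
        and large: "\<And>k. \<not> dir_deriv S (h ^^ L) ((h ^^ m k) (x k)) (dir S (h ^^ m k) (x k) (v k)) < 1/2"
      by metis
    define X V where "X k = (h ^^ m k) (x k)" and "V k = dir S (h ^^ m k) (x k) (v k)" for k
    have v: "rnorm S (x k) (v k) = 1" for k
      using bad[of k] by (simp add: bad_def)
    have V: "rnorm S (X k) (V k) = 1" for k
      unfolding X_def V_def by (rule unit[OF v])
    have orbit: "(h ^^ j) (X k) \<in> B \<and> (inv h ^^ j) (X k) \<in> B \<and>
        \<not> P ((inv h ^^ j) (X k)) (dir S (inv h ^^ j) (X k) (V k))" if "j \<le> k" for j k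
    proof -
      have j: "0 < m k + j" "m k + j \<le> n k" "0 < m k - j" "m k - j \<le> n k" "j \<le> m k"
        using m[of k] that by auto
      have "(h ^^ j) (X k) = (h ^^ (m k + j)) (x k)"
        by (simp add: X_def funpow_add add.commute[of "m k"])
      moreover have "(inv h ^^ j) (X k) = (h ^^ (m k - j)) (x k)"
        unfolding X_def by (rule funpow_inv_diff[OF bij j(5)])
      moreover have "dir S (inv h ^^ j) (X k) (V k) = dir S (h ^^ (m k - j)) (x k) (v k)"
        unfolding X_def V_def by (rule dir_funpow_diff[OF v j(5)])
      ultimately show ?thesis
        using bad[of k] j unfolding bad_def by simp
    qed
    obtain r y w where r: "strict_mono r" and t: "tconv S (\<lambda>k. X (r k)) (\<lambda>k. V (r k)) y w"
        and w: "rnorm S y w = 1"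
      by (rule unit_vectors_compact[OF comp V])
    \<comment> \<open>The control for \<open>j \<le> k\<close> survives the passage to the
      subsequence because \<open>k \<le> r k\<close>.\<close>
    have "y \<in> K" "w \<in> F y"
      using limit_of_orbits_in_F[OF t w] orbit order_trans[OF _ seq_suble[OF r]] by blast+
    then have "dir_deriv S (h ^^ L) y w < 1/2"
      using contr w by blast
    then have "eventually (\<lambda>k. dir_deriv S (h ^^ L) (X (r k)) (V (r k)) < 1/2) sequentially"
      by (rule order_tendstoD(2)[OF dir_deriv_tendsto[OF diffeo_funpow t unit_nonzero[OF w]]])
    then show False
      using large by (simp add: X_def V_def)
  qed
  then obtain M where M: "\<And>x v n m. bad x v n \<Longrightarrow> M \<le> m \<Longrightarrow> m + M \<le> n \<Longrightarrow>
      dir_deriv S (h ^^ L) ((h ^^ m) x) (dir S (h ^^ m) x v) < 1/2"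
    by blast
  \<comment> \<open>No contraction is available during the first \<open>M\<close> steps; compactness
    of the unit vectors at least bounds what they contribute.\<close>
  have "\<exists>A. \<forall>x v. rnorm S x v = 1 \<longrightarrow> dir_deriv S (h ^^ M) x v \<le> A"
  proof (rule ccontr)
    assume "\<not> ?thesis"
    then have "\<exists>x v. rnorm S x v = 1 \<and> real k < dir_deriv S (h ^^ M) x v" for k
      by (meson not_le)
    then obtain x v where v: "\<And>k. rnorm S (x k) (v k) = 1"
        and large: "\<And>k. real k < dir_deriv S (h ^^ M) (x k) (v k)"
      by metis
    obtain r y w where r: "strict_mono r" and t: "tconv S (\<lambda>k. x (r k)) (\<lambda>k. v (r k)) y w"
        and w: "rnorm S y w = 1"
      by (rule unit_vectors_compact[OF comp v])
    have "eventually (\<lambda>k. dir_deriv S (h ^^ M) (x (r k)) (v (r k)) < dir_deriv S (h ^^ M) y w + 1) sequentially"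
      by (rule order_tendstoD(2)[OF dir_deriv_tendsto[OF diffeo_funpow t unit_nonzero[OF w]]]) simp
    moreover have "eventually (\<lambda>k. dir_deriv S (h ^^ M) y w + 1 \<le> real k) sequentially"
      using filterlim_real_sequentially by (simp add: filterlim_at_top)
    ultimately have "eventually (\<lambda>k. False) sequentially"
    proof eventually_elim
      case (elim k)
      then show ?case
        using large[of "r k"] seq_suble[OF r, of k] by simp
    qed
    then show False
      by simp
  qed
  then obtain A where A: "\<And>x v. rnorm S x v = 1 \<Longrightarrow> dir_deriv S (h ^^ M) x v \<le> A"
    by blast
  have "(\<lambda>J. A * (1/2) ^ J) \<longlonglongrightarrow> 0"
    by (intro tendsto_mult_right_zero LIMSEQ_power_zero) simp
  then have "eventually (\<lambda>J. A * (1/2) ^ J < 1) sequentially"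
    by (rule order_tendstoD(2)) simp
  then obtain J where J: "A * (1/2) ^ J < 1"
    using eventually_happens'[OF sequentially_bot] by blast
  \<comment> \<open>The threshold leaves room for a margin \<open>M\<close> at the start,
    \<open>J\<close> blocks of length \<open>L\<close> and a margin \<open>M\<close> at the end; the
    added 1 keeps it positive. At time \<open>J * L + M\<close> the derivative is at most
    \<open>A * (1/2) ^ J\<close>, which is less than 1.\<close>
  have "\<exists>m. 0 < m \<and> m \<le> n \<and> P ((h ^^ m) x) (dir S (h ^^ m) x v)"
    if v: "rnorm S x v = 1" and crit: "\<And>j. dir_deriv S (h ^^ j) x v \<ge> 1" and n: "2 * M + J * L + 1 < n"
      and B: "\<And>j. 0 < j \<and> j \<le> n \<Longrightarrow> (h ^^ j) x \<in> B" for x v n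
  proof (rule ccontr)
    assume "\<not> ?thesis"
    then have bad: "bad x v n"
      using v B by (auto simp: bad_def)
    have "dir_deriv S (h ^^ (i * L + M)) x v \<le> A * (1/2) ^ i" if "i \<le> J" for i
      using that
    proof (induction i)
      case 0
      then show ?case
        using A[OF v] by simp
    next
      case (Suc i)
      have "i * L \<le> J * L"
        using Suc.prems by simp
      then have "dir_deriv S (h ^^ L) ((h ^^ (i * L + M)) x) (dir S (h ^^ (i * L + M)) x v) \<le> 1/2"
        by (intro less_imp_le[OF M[OF bad]]) (use n in linarith)+
      then have "dir_deriv S (h ^^ (L + (i * L + M))) x v \<le> 1/2 * (A * (1/2) ^ i)"
        unfolding dir_funpow_add(2)[OF v, of L "i * L + M"]
        by (rule mult_mono) (use Suc in auto)
      then show ?case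
        by (simp add: algebra_simps)
    qed
    then show False
      using crit[of "J * L + M"] J by force
  qed
  then show ?thesis
    by (intro exI[of _ "2 * M + J * L + 1"]) auto
qed

end

end

section \<open>Passage from the given data to the abstract setting\<close>

lemma (in surface) splittingI:
  assumes comp: "compact (UNIV :: 'm set)" and f: "C1_diffeo S f"
    and K: "f ` K = K" "closed K" and dom: "dominated_splitting S f K E F"
  shows "splitting S f K E F"
proof -
  obtain C r where C: "C > 0" "0 < r" "r < 1"
    and restr: "\<And>x n. x \<in> K \<Longrightarrow>
      restr_norm S (f ^^ n) x (E x) \<le> C * r ^ n * restr_norm S (f ^^ n) x (F x)"
    using dom unfolding dominated_splitting_def by blast
  have E: "line_subbundle S K E" and F: "line_subbundle S K F"
    using dom by (auto simp: dominated_splitting_def)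
  have "rnorm S ((f ^^ n) x) (differential S (f ^^ n) x v) * rnorm S x w \<le>
      C * r ^ n * (rnorm S ((f ^^ n) x) (differential S (f ^^ n) x w) * rnorm S x v)"
    if x: "x \<in> K" and v: "v \<in> E x" and w: "w \<in> F x" for x v w n
  proof -
    note fn = C1_map_funpow[OF C1_diffeo_map[OF f], of n]
    obtain e where e: "e \<in> E x" "rnorm S x e = 1" "E x = range (\<lambda>t. t *\<^sub>R e)"
      by (rule line_subbundle_unit[OF E x])
    obtain u where u: "u \<in> F x" "rnorm S x u = 1" "F x = range (\<lambda>t. t *\<^sub>R u)"
      by (rule line_subbundle_unit[OF F x])
    \<comment> \<open>The hypothesis compares unit generators only; both sides of the claim scale by
      \<open>\<bar>s\<bar> * \<bar>t\<bar>\<close>.\<close>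
    obtain s t where st: "v = s *\<^sub>R e" "w = t *\<^sub>R u"
      using v w e(3) u(3) by blast
    have "rnorm S ((f ^^ n) x) (differential S (f ^^ n) x e) \<le>
        C * r ^ n * rnorm S ((f ^^ n) x) (differential S (f ^^ n) x u)"
      using restr[OF x, of n] by (simp add: restr_norm_line[OF fn e] restr_norm_line[OF fn u])
    then have "\<bar>s\<bar> * \<bar>t\<bar> * rnorm S ((f ^^ n) x) (differential S (f ^^ n) x e) \<le>
        \<bar>s\<bar> * \<bar>t\<bar> * (C * r ^ n * rnorm S ((f ^^ n) x) (differential S (f ^^ n) x u))"
      by (rule mult_left_mono) simp
    then show ?thesis
      by (simp add: st linear_scale[OF linear_differential[OF fn]] e(2) u(2) mult_ac)
  qed
  then have "dominated S f K E F"
    unfolding dominated_def using C by blast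
  then show ?thesis
    by (intro splitting.intro splitting_axioms.intro)
      (use surface_axioms comp f K dom in \<open>auto simp: dominated_splitting_def\<close>)
qed

text \<open>A point lies in the image of a set under an iterate exactly if the opposite iterate
  takes it into the set. The intersection over all integers becomes a condition on the two
  half-orbits, the form used for \<open>K\<close> in the abstract argument.\<close>

lemma away_from_Crit_eq:
  assumes "bij f"
  shows "away_from_Crit S f \<Lambda> \<delta> = {y. \<forall>j. (f ^^ j) y \<in> \<Lambda> - nbhd \<delta> (Crit S f \<Lambda>) \<and>
    (inv f ^^ j) y \<in> \<Lambda> - nbhd \<delta> (Crit S f \<Lambda>)}"
proof -
  let ?B = "\<Lambda> - nbhd \<delta> (Crit S f \<Lambda>)"
  have img: "y \<in> g ` X \<longleftrightarrow> g' y \<in> X" if "\<And>x. g' (g x) = x" "\<And>x. g (g' x) = x"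
    for g g' :: "'a \<Rightarrow> 'a" and y X
    using that by (metis imageE imageI)
  note img' = img[of "inv f ^^ j" "f ^^ j" for j, OF funpow_inv_cancel[OF assms]]
    img[of "f ^^ j" "inv f ^^ j" for j, OF funpow_inv_cancel(2,1)[OF assms]]
  have "y \<in> away_from_Crit S f \<Lambda> \<delta> \<longleftrightarrow>
      (\<forall>j. y \<in> point_iter f (int j) ` ?B \<and> y \<in> point_iter f (- int j) ` ?B)" for y
  proof -
    have "y \<in> away_from_Crit S f \<Lambda> \<delta> \<longleftrightarrow> (\<forall>n::int. y \<in> point_iter f n ` ?B)"
      by (auto simp: away_from_Crit_def)
    then show ?thesis
      by (metis int_cases2)
  qed
  then show ?thesis
    unfolding point_iter_nat img' by blast
qed

lemma image_two_sided_orbit_set: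
  assumes "bij f" and K: "K = {y. \<forall>j. (f ^^ j) y \<in> B \<and> (inv f ^^ j) y \<in> B}"
  shows "f ` K = K"
proof -
  have *: "g y \<in> {y. \<forall>j. (g ^^ j) y \<in> B \<and> (inv g ^^ j) y \<in> B}"
    if "bij g" "\<forall>j. (g ^^ j) y \<in> B \<and> (inv g ^^ j) y \<in> B" for g :: "'a \<Rightarrow> 'a" and y
  proof -
    have "(g ^^ j) (g y) \<in> B" for j
      using that(2)[rule_format, of "Suc j"] by (simp only: funpow_Suc_right o_apply)
    \<comment> \<open>For \<open>j = 0\<close> the point is \<open>g y\<close> itself, which belongs
      to the forward half-orbit of \<open>y\<close>; the other indices shift by one.\<close>
    moreover have "(inv g ^^ j) (g y) \<in> B" for j
    proof (cases j)
      case 0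
      then show ?thesis
        using that(2)[rule_format, of 1] by simp
    next
      case (Suc i)
      then show ?thesis
        using that by (simp only: funpow_Suc_right o_apply bij_inv_apply)
    qed
    ultimately show ?thesis
      by blast
  qed
  have "f ` K \<subseteq> K" "inv f ` K \<subseteq> K"
    using *[OF assms(1)] *[OF bij_imp_bij_inv[OF assms(1)]] by (auto simp: K inv_inv_eq[OF assms(1)])
  then show ?thesis
    using bij_inv_apply(2)[OF assms(1)] by (metis image_eqI image_subset_iff subsetI subset_antisym)
qed

theorem proposition10:
  fixes S :: "'m::metric_space riem_surface"
    and f :: "'m \<Rightarrow> 'm"
    and \<Lambda> :: "'m set"
    and Q :: "'m chart set"
    and E F :: "'m \<Rightarrow> (real^2) set"
    and \<delta>\<^sub>0 \<delta> \<epsilon> :: real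
  assumes "riemannian_surface S" and "compact (UNIV :: 'm set)"
    and "local_coordinates S Q"
    and "C1_diffeo S f"
    and "compact \<Lambda>" and "f ` \<Lambda> = \<Lambda>"
    and "\<delta>\<^sub>0 > 0" and "away_from_Crit S f \<Lambda> \<delta>\<^sub>0 \<noteq> {}"
    and "\<epsilon> > 0" and "0 < \<delta>" and "\<delta> < \<delta>\<^sub>0"
    and "dominated_splitting S f (away_from_Crit S f \<Lambda> \<delta>) E F"
  shows "\<exists>N\<^sub>0::nat. N\<^sub>0 > 0 \<and>
    (\<forall>c v n. c \<in> Crit S f \<Lambda> \<and> critical_direction S f c v \<and> n > N\<^sub>0 \<and>
       (\<forall>j::nat. 0 < j \<and> j \<le> n \<longrightarrow> point_iter f (- int j) c \<notin> nbhd \<delta> (Crit S f \<Lambda>)) \<longrightarrow>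
       (\<exists>m::nat. 0 < m \<and> m \<le> n \<and>
          point_iter f (- int m) c \<in> nbhd \<epsilon> (away_from_Crit S f \<Lambda> \<delta>) \<and>
          slope_less S Q (away_from_Crit S f \<Lambda> \<delta>)
            (point_iter f (- int m) c) (proj_iter S f (- int m) c v) F \<epsilon>)) \<and>
    (\<forall>c v n. c \<in> Crit S f \<Lambda> \<and> critical_direction S f c v \<and> n > N\<^sub>0 \<and>
       (\<forall>j::nat. 0 < j \<and> j \<le> n \<longrightarrow> point_iter f (int j) c \<notin> nbhd \<delta> (Crit S f \<Lambda>)) \<longrightarrow>
       (\<exists>m::nat. 0 < m \<and> m \<le> n \<and>
          point_iter f (int m) c \<in> nbhd \<epsilon> (away_from_Crit S f \<Lambda> \<delta>) \<and>
          slope_less S Q (away_from_Crit S f \<Lambda> \<delta>)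
            (point_iter f (int m) c) (proj_iter S f (int m) c v) E \<epsilon>))"
proof -
  interpret surface S
    by (rule surface.intro) fact
  note f = \<open>C1_diffeo S f\<close>
  note bij = C1_diffeo_bij[OF f]
  define B K where "B = \<Lambda> - nbhd \<delta> (Crit S f \<Lambda>)" and "K = away_from_Crit S f \<Lambda> \<delta>"
  have "open (nbhd \<delta> (Crit S f \<Lambda>))"
    by (simp add: nbhd_def open_UN)
  then have B: "closed B"
    unfolding B_def using \<open>compact \<Lambda>\<close> by (intro closed_Diff compact_imp_closed)
  have K: "K = {y. \<forall>j. (f ^^ j) y \<in> B \<and> (inv f ^^ j) y \<in> B}"
    unfolding K_def B_def by (rule away_from_Crit_eq[OF bij])
  have "closed ((g ^^ j) -` B)" if "C1_diffeo S g" for g j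
    using C1_map_continuous[OF C1_map_funpow[OF C1_diffeo_map[OF that]]] B by (simp add: closed_vimage)
  from this[OF f] this[OF C1_diffeo_inv[OF f]]
  have "closed (\<Inter>j. (f ^^ j) -` B \<inter> (inv f ^^ j) -` B)"
    by auto
  also have "(\<Inter>j. (f ^^ j) -` B \<inter> (inv f ^^ j) -` B) = K"
    by (auto simp: K)
  finally have split: "splitting S f K E F"
    using splittingI[OF assms(2) f image_two_sided_orbit_set[OF bij K]] assms(12) by (simp add: K_def)
  note split' = splitting.splitting_inv[OF split]
  have K': "K = {y. \<forall>j. (inv f ^^ j) y \<in> B \<and> (inv (inv f) ^^ j) y \<in> B}"
    by (auto simp: K inv_inv_eq[OF bij])
  \<comment> \<open>Left open for any line field \<open>L\<close>: it is used with \<open>F\<close>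
    for (1) and with \<open>E\<close> for (2).\<close>
  have P: "eventually (\<lambda>k. slope_less S Q K (xs k) (vs k) L \<epsilon>) sequentially"
    if "tconv S xs vs z u" "z \<in> K" "u \<in> L z" "rnorm S z u = 1" for L xs vs z u
    by (rule slope_less_eventually[of Q xs vs z u K L, OF assms(3) that(1,2,3) unit_nonzero[OF that(4)] assms(9)])
  \<comment> \<open>\<open>slope_less\<close> already contains a point of \<open>K\<close> at
    distance less than \<epsilon>, so the condition on the slope brings the neighbourhood condition
    with it.\<close>
  have near: "x \<in> nbhd \<epsilon> K" if "slope_less S Q K x w L \<epsilon>" for x w L
    using that by (auto simp: slope_less_def nbhd_def dist_commute)
  \<comment> \<open>The hypothesis on the orbit of \<open>c\<close> says only that it avoids the
    neighbourhood of the critical points; membership in \<open>B\<close> also requires that it stay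
    in \<Lambda>.\<close>
  have \<Lambda>: "(f ^^ j) x \<in> \<Lambda> \<and> (inv f ^^ j) x \<in> \<Lambda>" if "x \<in> \<Lambda>" for x j
  proof -
    have "inv f y \<in> \<Lambda>" if "y \<in> \<Lambda>" for y
      using that assms(6) bij by (metis bij_inv_apply(1) imageE)
    then show ?thesis
      using that assms(6) by (induction j) auto
  qed
  have crit: "rnorm S c v = 1" "dir_deriv S (f ^^ j) c v \<ge> 1" "dir_deriv S (inv f ^^ j) c v \<ge> 1"
    if "critical_direction S f c v" for c v j
  proof -
    show v: "rnorm S c v = 1"
      using that by (simp add: critical_direction_def unit_vectors_def)
    show "dir_deriv S (f ^^ j) c v \<ge> 1" "dir_deriv S (inv f ^^ j) c v \<ge> 1"
      using that by (simp_all add: critical_direction_def flip: proj_deriv_nat[OF f v])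
  qed
  \<comment> \<open>The bundle listed first in \<open>splitting\<close> is the one approached:
    \<open>E\<close> when \<open>g\<close> is \<open>f\<close>, and \<open>F\<close> when
    \<open>g\<close> is \<open>inv f\<close>.\<close>
  have main: "\<exists>N>0. \<forall>x v n. rnorm S x v = 1 \<longrightarrow> (\<forall>j. dir_deriv S (g ^^ j) x v \<ge> 1) \<longrightarrow> N < n \<longrightarrow>
      (\<forall>j. 0 < j \<and> j \<le> n \<longrightarrow> (g ^^ j) x \<in> B) \<longrightarrow>
      (\<exists>m. 0 < m \<and> m \<le> n \<and> slope_less S Q K ((g ^^ m) x) (dir S (g ^^ m) x v) L \<epsilon>)"
    if "splitting S g K L L'" "K = {y. \<forall>j. (g ^^ j) y \<in> B \<and> (inv g ^^ j) y \<in> B}" for g L L'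
    by (rule splitting.critical_orbit_meets_E[OF that(1) B that(2)]) (rule P)
  obtain N1 where N1: "N1 > 0" "\<And>x v n. rnorm S x v = 1 \<Longrightarrow> (\<And>j. dir_deriv S (inv f ^^ j) x v \<ge> 1) \<Longrightarrow>
      N1 < n \<Longrightarrow> (\<And>j. 0 < j \<and> j \<le> n \<Longrightarrow> (inv f ^^ j) x \<in> B) \<Longrightarrow>
      \<exists>m. 0 < m \<and> m \<le> n \<and> slope_less S Q K ((inv f ^^ m) x) (dir S (inv f ^^ m) x v) F \<epsilon>"
    using main[OF split' K'] by blast
  obtain N2 where N2: "N2 > 0" "\<And>x v n. rnorm S x v = 1 \<Longrightarrow> (\<And>j. dir_deriv S (f ^^ j) x v \<ge> 1) \<Longrightarrow>
      N2 < n \<Longrightarrow> (\<And>j. 0 < j \<and> j \<le> n \<Longrightarrow> (f ^^ j) x \<in> B) \<Longrightarrow>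
      \<exists>m. 0 < m \<and> m \<le> n \<and> slope_less S Q K ((f ^^ m) x) (dir S (f ^^ m) x v) E \<epsilon>"
    using main[OF split K] by blast
  show ?thesis
    unfolding K_def[symmetric]
  proof (rule exI[of _ "max N1 N2"], intro conjI allI impI)
    show "0 < max N1 N2"
      using N1(1) by simp
  next
    fix c v n
    assume *: "c \<in> Crit S f \<Lambda> \<and> critical_direction S f c v \<and> max N1 N2 < n \<and>
      (\<forall>j::nat. 0 < j \<and> j \<le> n \<longrightarrow> point_iter f (- int j) c \<notin> nbhd \<delta> (Crit S f \<Lambda>))"
    then have v: "critical_direction S f c v"
      by blast
    have "(inv f ^^ j) c \<in> B" if "0 < j \<and> j \<le> n" for j
      using * that \<Lambda>[of c j] by (simp add: B_def Crit_def point_iter_nat)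
    then obtain m where "0 < m" "m \<le> n" "slope_less S Q K ((inv f ^^ m) c) (dir S (inv f ^^ m) c v) F \<epsilon>"
      using N1(2)[OF crit(1,3)[OF v], of n] * by auto
    then show "\<exists>m. 0 < m \<and> m \<le> n \<and> point_iter f (- int m) c \<in> nbhd \<epsilon> K \<and>
        slope_less S Q K (point_iter f (- int m) c) (proj_iter S f (- int m) c v) F \<epsilon>"
      using near unfolding point_iter_nat proj_iter_nat[OF f crit(1)[OF v]] by blast
  next
    fix c v n
    assume *: "c \<in> Crit S f \<Lambda> \<and> critical_direction S f c v \<and> max N1 N2 < n \<and>
      (\<forall>j::nat. 0 < j \<and> j \<le> n \<longrightarrow> point_iter f (int j) c \<notin> nbhd \<delta> (Crit S f \<Lambda>))"
    then have v: "critical_direction S f c v"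
      by blast
    have "(f ^^ j) c \<in> B" if "0 < j \<and> j \<le> n" for j
      using * that \<Lambda>[of c j] by (simp add: B_def Crit_def point_iter_nat)
    then obtain m where "0 < m" "m \<le> n" "slope_less S Q K ((f ^^ m) c) (dir S (f ^^ m) c v) E \<epsilon>"
      using N2(2)[OF crit(1,2)[OF v], of n] * by auto
    then show "\<exists>m. 0 < m \<and> m \<le> n \<and> point_iter f (int m) c \<in> nbhd \<epsilon> K \<and>
        slope_less S Q K (point_iter f (int m) c) (proj_iter S f (int m) c v) E \<epsilon>"
      using near unfolding point_iter_nat proj_iter_nat[OF f crit(1)[OF v]] by blast
  qed
qed

end
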